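(* For every graph $G$ with maximum degree at most $3$ (a subcubic graph), $\chi'_{inj}(G)\le 7$.
   Context: All graphs are finite and simple. An edge coloring of a graph $G$ (not necessarily proper) is \emph{injective} if any two distinct edges $e,f$ receive distinct colors whenever either (i) $e$ and $f$ share no vertex and some edge of $G$ joins an endpoint of $e$ to an endpoint of $f$ (i.e., $e,f$ are at distance exactly $1$), or (ii) $e$ and $f$ lie in a common triangle of $G$. The injective chromatic index $\chi'_{inj}(G)$ is the minimum number of colors in an injective edge coloring of $G$. *)

theory Defs
  imports Main
begin

definition simple_graph :: "'a set \<Rightarrow> 'a set set \<Rightarrow> bool" where
  "simple_graph V E \<longleftrightarrow> finite V \<and> (\<forall>e\<in>E. e \<subseteq> V \<and> card e = 2)"

definition degree :: "'a set set \<Rightarrow> 'a \<Rightarrow> nat" where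
  "degree E v = card {e\<in>E. v \<in> e}"

definition max_degree_le :: "'a set \<Rightarrow> 'a set set \<Rightarrow> nat \<Rightarrow> bool" where
  "max_degree_le V E d \<longleftrightarrow> (\<forall>v\<in>V. degree E v \<le> d)"

definition edges_dist1 :: "'a set set \<Rightarrow> 'a set \<Rightarrow> 'a set \<Rightarrow> bool" where
  "edges_dist1 E e f \<longleftrightarrow> e \<inter> f = {} \<and> (\<exists>u\<in>e. \<exists>w\<in>f. {u, w} \<in> E)"

definition in_common_triangle :: "'a set set \<Rightarrow> 'a set \<Rightarrow> 'a set \<Rightarrow> bool" where
  "in_common_triangle E e f \<longleftrightarrow>
     (\<exists>x y z. x \<noteq> y \<and> y \<noteq> z \<and> x \<noteq> z \<and> {x,y} \<in> E \<and> {y,z} \<in> E \<and> {x,z} \<in> E \<and>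
        e \<in> {{x,y},{y,z},{x,z}} \<and> f \<in> {{x,y},{y,z},{x,z}})"

definition injective_edge_coloring :: "'a set set \<Rightarrow> ('a set \<Rightarrow> nat) \<Rightarrow> nat \<Rightarrow> bool" where
  "injective_edge_coloring E c k \<longleftrightarrow>
     (\<forall>e\<in>E. c e < k) \<and>
     (\<forall>e\<in>E. \<forall>f\<in>E. e \<noteq> f \<and> (edges_dist1 E e f \<or> in_common_triangle E e f) \<longrightarrow> c e \<noteq> c f)"

definition injective_chromatic_index :: "'a set set \<Rightarrow> nat" where
  "injective_chromatic_index E = (LEAST k. \<exists>c. injective_edge_coloring E c k)"

end

theory Submission
  imports Defs
begin

text \<open>
  A colouring is injective iff the first and last edges of every walk with three edges and no
  immediate return (closed or not) have different colours. A triangle can be removed: after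
  colouring the rest, the pendant edges of the triangle and then its own edges still have enough
  free colours.

  In a triangle-free graph fix a maximal independent set B, put A = V - B, and give all edges from
  a vertex a of A to B the same colour, the star colour of a. The graph induced on A has maximum
  degree 2. Its edges use the colours 5 and 6, except that on each cycle the two edges at one marked
  vertex are recoloured with a colour below 5, so that what remains to be 2-coloured is acyclic. The
  star colours are chosen greedily: first on the 5-core of the graph of star conflicts, where 5 and 6
  may be used if no nearby edge has that colour, then on the other vertices off the cycles, and
  finally on the cycles. The greedy choices succeed when B minimises first the set of vertices on
  cycles of A, then the number of vertices of A with three neighbours in B.
\<close>

text \<open>The edges of one star share a vertex and so never conflict. A vertex of A with k
  neighbours in B has at most (3 - k) + 2k = 3 + k star conflicts, so five colours can fail only
  around vertices with k = 2 or k = 3, and these have at most one neighbour in A. Few edges inside A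
  come near them, so the 5-core can borrow 5 and 6.

  On a cycle of n edges inside A, conflicting edges are two apart, so two colours suffice only if 4
  divides n. The two edges at a marked vertex do not conflict with each other, and removing them
  leaves a path. Their new colours and the star colours on the cycle must share the colours below 5.
  There is room because a cycle vertex has just one neighbour in B and no two cycle vertices have a
  common neighbour in B; the latter is what the first minimisation provides. The second one serves a
  vertex of the 5-core with three neighbours in B, near which both 5 and 6 might otherwise be
  taken.\<close>

section \<open>Greedy list colouring and distinct representatives\<close>

text \<open>The element supplied for the whole set is coloured last: its neighbours cannot exhaust
  its list. All greedy colourings below are instances, so the order in which elements are exhibited
  for shrinking \<open>T\<close> is the reverse of the order of colouring.\<close>

lemma degenerate_list_coloring:
  fixes L :: "'a \<Rightarrow> 'c set"
  assumes "finite X" and sym: "\<And>x y. R x y \<Longrightarrow> R y x" and irr: "\<And>x. \<not> R x x"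
    and "\<And>T. T \<subseteq> X \<Longrightarrow> T \<noteq> {} \<Longrightarrow> \<exists>x\<in>T. card {y \<in> T. R x y} < card (L x)"
  shows "\<exists>c. (\<forall>x\<in>X. c x \<in> L x) \<and> (\<forall>x\<in>X. \<forall>y\<in>X. R x y \<longrightarrow> c x \<noteq> c y)"
  using assms(1,4)
proof (induction "card X" arbitrary: X)
  case 0
  then show ?case by auto
next
  case (Suc n)
  from Suc.hyps(2) have "X \<noteq> {}" by auto
  then obtain x where x: "x \<in> X" "card {y \<in> X. R x y} < card (L x)"
    using Suc.prems(2)[of X] by auto
  have "n = card (X - {x})" using Suc.hyps(2) x(1) Suc.prems(1) by simp
  then obtain c where c: "\<forall>z\<in>X - {x}. c z \<in> L z"
      "\<forall>z\<in>X - {x}. \<forall>y\<in>X - {x}. R z y \<longrightarrow> c z \<noteq> c y"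
    using Suc.hyps(1)[of "X - {x}"] Suc.prems(1) Suc.prems(2) by (auto simp: subset_Diff_insert)
  let ?U = "c ` {y \<in> X. R x y}"
  have fin: "finite ?U" using Suc.prems(1) by simp
  have "card ?U \<le> card {y \<in> X. R x y}" by (rule card_image_le) (use Suc.prems(1) in simp)
  with x(2) have "card ?U < card (L x)" by simp
  then have "\<not> L x \<subseteq> ?U" using card_mono[OF fin] by (meson leD)
  then obtain k where k: "k \<in> L x" "k \<notin> ?U" by blast
  have "(\<forall>z\<in>X. (c(x := k)) z \<in> L z) \<and>
      (\<forall>z\<in>X. \<forall>y\<in>X. R z y \<longrightarrow> (c(x := k)) z \<noteq> (c(x := k)) y)"
    using c k irr sym by auto
  then show ?case by blast
qed

text \<open>Hall's theorem for three sets. Unless all sets are equal, some element of one set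
  \<open>S i\<close> is missing from another set \<open>S j\<close>. Choose it first, then an
  element of the third set, then one of \<open>S j\<close>, which has only the second choice left to
  avoid.\<close>

lemma three_distinct_representatives:
  fixes S :: "'a \<Rightarrow> 'c set"
  assumes "distinct [u, v, w]" and "\<And>x. x \<in> {u, v, w} \<Longrightarrow> 2 \<le> card (S x)"
    and "3 \<le> card (S u \<union> S v \<union> S w)"
  shows "\<exists>t. t u \<in> S u \<and> t v \<in> S v \<and> t w \<in> S w \<and> t u \<noteq> t v \<and> t v \<noteq> t w \<and> t u \<noteq> t w"
proof -
  have pick: "\<exists>y\<in>S x. y \<noteq> k" if "x \<in> {u, v, w}" for x k
  proof (rule ccontr)
    assume "\<not> ?thesis"
    then have "S x \<subseteq> {k}" by auto
    then have "card (S x) \<le> 1" using card_mono[of "{k}" "S x"] by simp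
    then show False using assms(2)[OF that] by simp
  qed
  have ext: "\<exists>t. t u \<in> S u \<and> t v \<in> S v \<and> t w \<in> S w \<and> t u \<noteq> t v \<and> t v \<noteq> t w \<and> t u \<noteq> t w"
    if "a \<in> S u" "b \<in> S v" "c \<in> S w" "a \<noteq> b" "b \<noteq> c" "a \<noteq> c" for a b c
    by (rule exI[of _ "\<lambda>x. if x = u then a else if x = v then b else c"])
      (use that assms(1) in auto)
  have main: "\<exists>xi\<in>S i. \<exists>xj\<in>S j. \<exists>xk\<in>S k. xi \<noteq> xj \<and> xj \<noteq> xk \<and> xi \<noteq> xk"
    if ijk: "i \<in> {u,v,w}" "j \<in> {u,v,w}" "k \<in> {u,v,w}" and nsub: "\<not> S i \<subseteq> S j" for i j k
  proof -
    obtain xi where xi: "xi \<in> S i" "xi \<notin> S j" using nsub by blast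
    obtain xk where xk: "xk \<in> S k" "xk \<noteq> xi" using pick[OF ijk(3)] by blast
    obtain xj where xj: "xj \<in> S j" "xj \<noteq> xk" using pick[OF ijk(2)] by blast
    have "xi \<noteq> xj" using xi(2) xj(1) by blast
    then show ?thesis using xi xk xj by blast
  qed
  show ?thesis
  proof (cases "S u = S v \<and> S v = S w")
    case True
    then have "3 \<le> card (S u)" using assms(3) by simp
    then obtain F where F: "F \<subseteq> S u" "card F = 3"
      by (meson obtain_subset_with_card_n)
    then obtain a b c where "F = {a, b, c}" "a \<noteq> b" "b \<noteq> c" "a \<noteq> c"
      by (metis card_3_iff)
    then show ?thesis using ext[of a b c] F True by auto
  next
    case False
    then consider "\<not> S u \<subseteq> S v" | "\<not> S v \<subseteq> S u" | "\<not> S v \<subseteq> S w" | "\<not> S w \<subseteq> S v"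
      by blast
    then show ?thesis
    proof cases
      case 1 then show ?thesis using main[of u v w] ext by blast
    next
      case 2 then show ?thesis using main[of v u w] ext by (metis insert_iff)
    next
      case 3 then show ?thesis using main[of v w u] ext by (metis insert_iff)
    next
      case 4 then show ?thesis using main[of w v u] ext by (metis insert_iff)
    qed
  qed
qed

text \<open>If all three sets of admissible colours agreed and had two elements, the forbidden sets
  would be one and the same five-element set, and then F u and F v would share a colour.\<close>

lemma three_lists_union:
  fixes p :: "'a \<Rightarrow> nat" and F :: "'a \<Rightarrow> nat set"
  assumes "distinct [u, v, w]"
    and F: "\<And>x. x \<in> {u, v, w} \<Longrightarrow> finite (F x) \<and> card (F x) \<le> 2"
  defines "S x \<equiv> {..<7} - ({p x} \<union> (\<Union>y\<in>{u, v, w} - {x}. F y))"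
  shows "\<And>x. x \<in> {u, v, w} \<Longrightarrow> 2 \<le> card (S x)" and "3 \<le> card (S u \<union> S v \<union> S w)"
proof -
  have Q: "card ({p x} \<union> (F y \<union> F z)) \<le> 5" if "y \<in> {u,v,w}" "z \<in> {u,v,w}" for x y z
  proof -
    have "card ({p x} \<union> (F y \<union> F z)) \<le> card {p x} + card (F y \<union> F z)" by (rule card_Un_le)
    also have "card (F y \<union> F z) \<le> card (F y) + card (F z)" by (rule card_Un_le)
    finally show ?thesis using F[OF that(1)] F[OF that(2)] by simp
  qed
  have Su: "S u = {..<7} - ({p u} \<union> (F v \<union> F w))" and Sv: "S v = {..<7} - ({p v} \<union> (F u \<union> F w))"
    and Sw: "S w = {..<7} - ({p w} \<union> (F u \<union> F v))"
    using assms(1) unfolding S_def by auto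
  have two: "2 \<le> card ({..<7} - X)" if "card X \<le> 5" "finite X" for X :: "nat set"
    using diff_card_le_card_Diff[OF that(2), of "{..<7}"] that(1) by simp
  show star_adj: "2 \<le> card (S x)" if "x \<in> {u, v, w}" for x
  proof -
    have "finite (F u)" "finite (F v)" "finite (F w)" using F by auto
    then show ?thesis using that Su Sv Sw two Q by auto
  qed
  have fin: "finite (S x)" for x unfolding S_def by simp
  show "3 \<le> card (S u \<union> S v \<union> S w)"
  proof (rule ccontr)
    let ?U = "S u \<union> S v \<union> S w"
    assume "\<not> 3 \<le> card ?U"
    then have le: "card ?U \<le> 2" by simp
    have eq: "S x = ?U" if "x \<in> {u,v,w}" for x
    proof (rule card_subset_eq)
      show "finite ?U" using fin by simp
      show sub: "S x \<subseteq> ?U" using that by auto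
      show "card (S x) = card ?U"
        using card_mono[OF \<open>finite ?U\<close> sub] le star_adj[OF that] by linarith
    qed
    have c2: "card ?U = 2" using le star_adj[of u] eq[of u] by simp
    have five: "card ({p x} \<union> (F y \<union> F z)) = 5 \<and> {p x} \<union> (F y \<union> F z) = {..<7} - ?U"
      if "{..<7} - ({p x} \<union> (F y \<union> F z)) = ?U" "y \<in> {u,v,w}" "z \<in> {u,v,w}" for x y z
    proof -
      let ?X = "{p x} \<union> (F y \<union> F z)"
      have fX: "finite ?X" using F that(2,3) by auto
      have sub: "{..<7} - ?U \<subseteq> ?X" using that(1) by auto
      have "card ({..<7} - ?U) = 5"
        using card_Diff_subset[of ?U "{..<7}"] c2 fin S_def by auto
      then have "card ?X = 5" "{..<7} - ?U = ?X"
        using Q[OF that(2,3), of x] card_mono[OF fX sub] card_subset_eq[OF fX sub] by auto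
      then show ?thesis by simp
    qed
    have A: "card ({p u} \<union> (F v \<union> F w)) = 5" "{p u} \<union> (F v \<union> F w) = {..<7} - ?U"
      using five[of u v w] eq[of u] Su by auto
    have B: "card ({p v} \<union> (F u \<union> F w)) = 5" "{p v} \<union> (F u \<union> F w) = {..<7} - ?U"
      using five[of v u w] eq[of v] Sv by auto
    have C: "card ({p w} \<union> (F u \<union> F v)) = 5" "{p w} \<union> (F u \<union> F v) = {..<7} - ?U"
      using five[of w u v] eq[of w] Sw by auto
    \<comment> \<open>Equality in the bound 1 + 2 + 2 forces the three parts of a forbidden set to
      be disjoint and of full size.\<close>
    have dj: "p x \<notin> F y \<and> F y \<inter> F z = {} \<and> card (F y) = 2"
      if "card ({p x} \<union> (F y \<union> F z)) = 5" "y \<in> {u,v,w}" "z \<in> {u,v,w}" for x y z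
    proof -
      have f: "finite (F y)" "finite (F z)" "card (F y) \<le> 2" "card (F z) \<le> 2" using F that by auto
      have 1: "card (F y \<union> F z) + card (F y \<inter> F z) = card (F y) + card (F z)"
        using card_Un_Int[OF f(1,2)] by simp
      have 2: "card ({p x} \<union> (F y \<union> F z)) = (if p x \<in> F y \<union> F z then 0 else 1) + card (F y \<union> F z)"
        using f by (simp add: card_insert_if)
      have "p x \<notin> F y \<union> F z" using 1 2 f that(1) by (auto split: if_splits)
      then have "card (F y \<inter> F z) = 0" "card (F y) = 2" using 1 2 f(3,4) that(1) by simp_all
      then show ?thesis using f \<open>p x \<notin> F y \<union> F z\<close> by auto
    qed
    have e1: "F v \<inter> F w = {}" using dj[of u v w] A(1) by auto
    have e2: "F u \<inter> F w = {}" "card (F u) = 2" using dj[of v u w] B(1) by auto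
    have e3: "F u \<inter> F v = {}" using dj[of w u v] C(1) by auto
    have "{p u} \<union> (F v \<union> F w) = {p v} \<union> (F u \<union> F w)" using A(2) B(2) by simp
    then have "F u \<subseteq> {p u}" using e1 e2 e3 by blast
    then have "card (F u) \<le> 1" using card_mono[of "{p u}" "F u"] by simp
    then show False using e2 by simp
  qed
qed

section \<open>Three-edge walks and the removal of a triangle\<close>

text \<open>In a graph, a walk with \<open>a = d\<close> gives two edges of a triangle, and one with
  four distinct vertices gives two edges at distance one. One condition thus covers both clauses of
  injectivity.\<close>

definition walk_injective :: "('a \<Rightarrow> 'a set) \<Rightarrow> ('a set \<Rightarrow> nat) \<Rightarrow> bool" where
  "walk_injective N c \<longleftrightarrow>
     (\<forall>a b x d. b \<in> N a \<longrightarrow> x \<in> N b \<longrightarrow> d \<in> N x \<longrightarrow> a \<noteq> x \<longrightarrow> b \<noteq> d \<longrightarrow> c {a, b} \<noteq> c {x, d})"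

locale subcubic_graph =
  fixes V :: "'a set" and N :: "'a \<Rightarrow> 'a set"
  assumes finite_V: "finite V" and N_subset: "N v \<subseteq> V"
    and N_sym: "w \<in> N v \<Longrightarrow> v \<in> N w" and N_irrefl: "v \<notin> N v" and card_N: "card (N v) \<le> 3"
begin

lemma finite_N [simp]: "finite (N v)"
  using finite_V N_subset finite_subset by blast

lemma card_N_minus: "x \<in> N y \<Longrightarrow> card (N y - {x}) \<le> 2"
  using card_N[of y] by simp

text \<open>A pendant edge of the triangle sees at most four edges beyond its outer end, so three
  colours remain, enough to make the pendant edges pairwise different. The side opposite
  \<open>x\<close> sees the pendant edge at \<open>x\<close> and at most two further edges at the
  outer neighbour of each other corner, so two colours remain. Two per side is not enough in
  general; \<open>three_lists_union\<close> excludes the bad case.\<close>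

lemma triangle_extension:
  assumes dist: "distinct [u, v, w]" and tri: "v \<in> N u" "w \<in> N v" "w \<in> N u"
  defines "T \<equiv> {u, v, w}"
  defines "N' \<equiv> \<lambda>x. if x \<in> T then {} else N x - T"
  assumes c': "\<And>a b. b \<in> N' a \<Longrightarrow> c' {a, b} < (7::nat)" and inj: "walk_injective N' c'"
  shows "\<exists>c. (\<forall>a b. b \<in> N a \<longrightarrow> c {a, b} < 7) \<and> walk_injective N c"
proof -
  have T_adj: "b \<in> N a" if "a \<in> T" "b \<in> T" "a \<noteq> b" for a b
    using that tri N_sym unfolding T_def by auto
  have finT: "finite T" "card T = 3" using dist unfolding T_def by auto
  define O' where "O' x = N x - T" for x
  have O1: "card (O' x) \<le> 1" if x: "x \<in> T" for x
  proof -
    have "T - {x} \<subseteq> N x" using T_adj x by auto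
    moreover have "card (T - {x}) = 2" using x finT by simp
    moreover have "O' x \<subseteq> N x - (T - {x})" unfolding O'_def by auto
    ultimately show ?thesis
      using card_N[of x] card_Diff_subset[of "T - {x}" "N x"] finT
        card_mono[of "N x - (T - {x})" "O' x"] by auto
  qed
  have O_uniq: "y = z" if "x \<in> T" "y \<in> O' x" "z \<in> O' x" for x y z
    using O1[OF that(1)] that(2,3) card_le_Suc0_iff_eq[of "O' x"] unfolding O'_def by auto
  have O_cases: "O' x = {} \<or> (\<exists>y. O' x = {y})" if "x \<in> T" for x
    using O_uniq[OF that] by blast
  have O_N: "x \<in> N y" if "y \<in> O' x" for x y using that N_sym unfolding O'_def by auto
  \<comment> \<open>The colours met one edge beyond the outer neighbour \<open>y\<close> of the
    corner \<open>x\<close>: at most two choices of \<open>b\<close>, then at most two of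
    \<open>a\<close>.\<close>
  define P where "P x = (\<Union>y\<in>O' x. \<Union>b\<in>N y - {x}. (\<lambda>a. c' {a, b}) ` (N b - {y}))" for x
  have P: "finite (P x)" "card (P x) \<le> 4" if x: "x \<in> T" for x
  proof -
    show "finite (P x)" unfolding P_def O'_def by auto
    show "card (P x) \<le> 4" using O_cases[OF x]
    proof (elim disjE exE)
      assume "O' x = {}"
      then show ?thesis unfolding P_def by simp
    next
      fix y assume y: "O' x = {y}"
      have "card (P x) \<le> (\<Sum>b\<in>N y - {x}. card ((\<lambda>a. c' {a, b}) ` (N b - {y})))"
        unfolding P_def y by (simp add: card_UN_le)
      also have "\<dots> \<le> (\<Sum>b\<in>N y - {x}. 2)"
      proof (rule sum_mono)
        fix b assume "b \<in> N y - {x}"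
        then have "card (N b - {y}) \<le> 2" using card_N_minus N_sym by auto
        then show "card ((\<lambda>a. c' {a, b}) ` (N b - {y})) \<le> 2"
          using card_image_le[of "N b - {y}" "\<lambda>a. c' {a, b}"] by simp
      qed
      also have "\<dots> \<le> 4" using card_N_minus[of x y] O_N y by auto
      finally show ?thesis .
    qed
  qed
  have "\<exists>p. (\<forall>x\<in>T. p x \<in> {..<7} - P x) \<and> (\<forall>x\<in>T. \<forall>y\<in>T. x \<noteq> y \<longrightarrow> p x \<noteq> p y)"
  proof (rule degenerate_list_coloring)
    fix S assume S: "S \<subseteq> T" "S \<noteq> {}"
    then obtain x where x: "x \<in> S" by blast
    have "x \<in> T" using x S by auto
    have "card {y \<in> S. x \<noteq> y} \<le> card (T - {x})" by (rule card_mono) (use S finT in auto)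
    moreover have "card (T - {x}) = 2" using \<open>x \<in> T\<close> finT by simp
    moreover have "3 \<le> card ({..<7} - P x)"
      using diff_card_le_card_Diff[OF P(1), of x "{..<7}"] P(2)[of x] \<open>x \<in> T\<close> by simp
    ultimately have "card {y \<in> S. x \<noteq> y} < card ({..<7} - P x)" by linarith
    then show "\<exists>x\<in>S. card {y \<in> S. x \<noteq> y} < card ({..<7} - P x)" using x by blast
  qed (use finT in auto)
  then obtain p where p: "\<And>x. x \<in> T \<Longrightarrow> p x < 7 \<and> p x \<notin> P x"
    and p_dist: "\<And>x y. x \<in> T \<Longrightarrow> y \<in> T \<Longrightarrow> x \<noteq> y \<Longrightarrow> p x \<noteq> p y" by auto
  \<comment> \<open>Two corners may have the same outer neighbour. An edge at that vertex is then
    itself pendant and has a colour from \<open>p\<close>, not from \<open>c'\<close>.\<close>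
  define q where "q z y = (if z \<in> T then p z else c' {z, y})" for z y
  define F where "F x = (\<Union>y\<in>O' x. (\<lambda>z. q z y) ` (N y - {x}))" for x
  have F: "finite (F x) \<and> card (F x) \<le> 2" if x: "x \<in> T" for x
    using O_cases[OF x]
  proof (elim disjE exE)
    assume "O' x = {}"
    then show ?thesis unfolding F_def by simp
  next
    fix y assume y: "O' x = {y}"
    have "card (N y - {x}) \<le> 2" using card_N_minus[of x y] O_N y by auto
    then show ?thesis unfolding F_def y
      using card_image_le[of "N y - {x}" "\<lambda>z. q z y"] by simp
  qed
  define S where "S x = {..<7} - ({p x} \<union> (\<Union>y\<in>{u, v, w} - {x}. F y))" for x
  have "\<exists>t. t u \<in> S u \<and> t v \<in> S v \<and> t w \<in> S w \<and> t u \<noteq> t v \<and> t v \<noteq> t w \<and> t u \<noteq> t w"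
    by (rule three_distinct_representatives[OF dist])
      (use three_lists_union[OF dist, where F = F and p = p] F in \<open>auto simp: S_def T_def\<close>)
  then obtain t where t0: "t u \<in> S u" "t v \<in> S v" "t w \<in> S w"
    "t u \<noteq> t v" "t v \<noteq> t w" "t u \<noteq> t w" by blast
  have t: "t x < 7" "t x \<noteq> p x" if "x \<in> T" for x
    using that t0(1-3) unfolding T_def S_def by auto
  have t_F: "t x \<notin> F y" if "x \<in> T" "y \<in> T" "x \<noteq> y" for x y
    using that t0(1-3) unfolding T_def S_def by auto
  have t_dist: "t x \<noteq> t y" if "x \<in> T" "y \<in> T" "x \<noteq> y" for x y
    using that t0(4-6) unfolding T_def by auto
  \<comment> \<open>A side takes the colour \<open>t\<close> of the opposite corner, a pendant edge
    the colour \<open>p\<close> of its own corner.\<close>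
  define col where "col e = (if e \<inter> T = {} then c' e else if e \<subseteq> T then t (THE z. z \<in> T - e)
    else p (THE z. z \<in> e \<inter> T))" for e
  have col_out: "col {a, b} = c' {a, b}" if "a \<notin> T" "b \<notin> T" for a b
    using that unfolding col_def by auto
  have col_pend: "col {a, b} = p a" "col {b, a} = p a" if "a \<in> T" "b \<notin> T" for a b
  proof -
    have "(THE z. z \<in> {a, b} \<inter> T) = a" using that by auto
    then show "col {a, b} = p a" using that unfolding col_def by auto
    then show "col {b, a} = p a" by (simp add: insert_commute)
  qed
  have col_tri: "col {a, b} = t z" if "a \<in> T" "b \<in> T" "a \<noteq> b" "z \<in> T" "z \<noteq> a" "z \<noteq> b" for a b z
  proof -
    have "T - {a, b} = {z}" using that unfolding T_def by auto
    then show ?thesis using that unfolding col_def by auto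
  qed
  have third: "\<exists>z\<in>T. z \<noteq> a \<and> z \<noteq> b" for a b using dist unfolding T_def by auto
  have bound: "col {a, b} < 7" if "b \<in> N a" for a b
  proof -
    have "a \<noteq> b" using that N_irrefl by auto
    then show ?thesis
      using third[of a b] col_out[of a b] col_pend[of a b] col_pend[of b a] col_tri[of a b] p t c'[of b a] that
      by (cases "a \<in> T"; cases "b \<in> T") (auto simp: N'_def)
  qed
  define W where "W a b x d \<longleftrightarrow> b \<in> N a \<and> x \<in> N b \<and> d \<in> N x \<and> a \<noteq> x \<and> b \<noteq> d" for a b x d
  have W_rev: "W d x b a" if "W a b x d" for a b x d using that N_sym unfolding W_def by auto
  have W_ne: "a \<noteq> b" "b \<noteq> x" "x \<noteq> d" if "W a b x d" for a b x d
    using that N_irrefl unfolding W_def by auto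
  have out_out: "col {a, b} \<noteq> col {x, d}" if "W a b x d" "a \<notin> T" "b \<notin> T" "x \<notin> T" "d \<notin> T" for a b x d
    using that inj unfolding walk_injective_def W_def N'_def by (auto simp: col_out)
  have out_pend1: False if "W a b x d" "a \<notin> T" "b \<notin> T" "x \<in> T" "d \<notin> T" for a b x d
    using O_uniq[of x b d] that N_sym unfolding W_def O'_def by auto
  have out_pend2: "col {a, b} \<noteq> col {x, d}" if "W a b x d" "a \<notin> T" "b \<notin> T" "x \<notin> T" "d \<in> T" for a b x d
  proof -
    have "c' {a, b} \<in> P d" using that N_sym unfolding W_def P_def O'_def by blast
    then show ?thesis using that p col_out col_pend by metis
  qed
  have out_tri: "col {a, b} \<noteq> col {x, d}" if "W a b x d" "a \<notin> T" "b \<notin> T" "x \<in> T" "d \<in> T" for a b x d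
  proof -
    obtain z where z: "z \<in> T" "z \<noteq> x" "z \<noteq> d" using third by blast
    have "q a b \<in> F x" using that N_sym unfolding W_def F_def O'_def by blast
    then have "c' {a, b} \<in> F x" using that unfolding q_def by simp
    then show ?thesis using that z t_F[of z x] col_out col_tri[of x d z] W_ne[OF that(1)] by metis
  qed
  have pend_pend: "col {a, b} \<noteq> col {x, d}"
    if "W a b x d" "a \<in> T \<longleftrightarrow> b \<notin> T" "x \<in> T \<longleftrightarrow> d \<notin> T" for a b x d
  proof -
    define i where "i = (if a \<in> T then a else b)"
    define j where "j = (if x \<in> T then x else d)"
    \<comment> \<open>If both edges were pendant at one corner, that corner would have two outer
      neighbours.\<close>
    have "a \<noteq> d" if aT: "a \<in> T" and xT: "x \<notin> T"
    proof
      assume "a = d"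
      then have "b \<in> O' a" "x \<in> O' a"
        using \<open>W a b x d\<close> \<open>a \<in> T \<longleftrightarrow> b \<notin> T\<close> aT xT N_sym[of d x] unfolding W_def O'_def by auto
      then show False using O_uniq[OF aT] W_ne(2)[OF \<open>W a b x d\<close>] by blast
    qed
    then have "i \<noteq> j"
      using that W_ne[OF that(1)] unfolding i_def j_def W_def by auto
    moreover have "i \<in> T" "j \<in> T" "col {a, b} = p i" "col {x, d} = p j"
      using that col_pend unfolding i_def j_def by auto
    ultimately show ?thesis using p_dist by metis
  qed
  have pend_tri1: "col {a, b} \<noteq> col {x, d}" if "W a b x d" "a \<in> T" "b \<notin> T" "x \<in> T" "d \<in> T" for a b x d
  proof -
    obtain z where z: "z \<in> T" "z \<noteq> x" "z \<noteq> d" using third by blast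
    have "q a b \<in> F x" using that N_sym unfolding W_def F_def O'_def by blast
    then have "p a \<in> F x" using that unfolding q_def by simp
    then show ?thesis using that z t_F[of z x] col_pend col_tri[of x d z] W_ne[OF that(1)] by metis
  qed
  have pend_tri2: "col {a, b} \<noteq> col {x, d}" if "W a b x d" "a \<notin> T" "b \<in> T" "x \<in> T" "d \<in> T" for a b x d
    using that t(2)[of b] col_pend[of b a] col_tri[of x d b] W_ne[OF that(1)] unfolding W_def by metis
  have tri_tri: "col {a, b} \<noteq> col {x, d}" if "W a b x d" "a \<in> T" "b \<in> T" "x \<in> T" "d \<in> T" for a b x d
  proof -
    have "a = d" using that W_ne[OF that(1)] dist unfolding W_def T_def by auto
    then show ?thesis
      using that t_dist[of x b] col_tri[of a b x] col_tri[of x d b] W_ne[OF that(1)]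
      unfolding W_def by metis
  qed
  have "col {a, b} \<noteq> col {x, d}" if W: "W a b x d" for a b x d
  proof -
    note R = W_rev[OF W]
    have flip: "col {a, b} \<noteq> col {x, d}" if "col {d, x} \<noteq> col {b, a}"
      using that by (metis insert_commute)
    consider "a \<notin> T" "b \<notin> T" | "a \<in> T \<longleftrightarrow> b \<notin> T" | "a \<in> T" "b \<in> T" by blast
    then show ?thesis
    proof cases
      case 1
      then show ?thesis using out_out[OF W] out_pend1[OF W] out_pend2[OF W] out_tri[OF W] by blast
    next
      case 2
      consider "x \<notin> T" "d \<notin> T" | "x \<in> T \<longleftrightarrow> d \<notin> T" | "x \<in> T" "d \<in> T" by blast
      then show ?thesis
      proof cases
        case 1
        then show ?thesis using 2 out_pend1[OF R] flip[OF out_pend2[OF R]] by blast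
      next
        case 2
        then show ?thesis using \<open>a \<in> T \<longleftrightarrow> b \<notin> T\<close> pend_pend[OF W] by blast
      next
        case 3
        then show ?thesis using 2 pend_tri1[OF W] pend_tri2[OF W] by blast
      qed
    next
      case 3
      then show ?thesis
        using tri_tri[OF W] flip[OF out_tri[OF R]] flip[OF pend_tri1[OF R]] flip[OF pend_tri2[OF R]] by blast
    qed
  qed
  then have "walk_injective N col" unfolding walk_injective_def W_def by blast
  then show ?thesis using bound by blast
qed

end

section \<open>Maximal independent sets and the cycles outside them\<close>

context subcubic_graph
begin

definition max_indep :: "'a set \<Rightarrow> bool" where
  "max_indep B \<longleftrightarrow> B \<subseteq> V \<and> (\<forall>b\<in>B. N b \<inter> B = {}) \<and> (\<forall>v\<in>V - B. N v \<inter> B \<noteq> {})"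

text \<open>For a maximal independent set B this is the union of the cycles of the graph induced on V - B,
  since every vertex outside B has at most two neighbours outside B.\<close>

definition core :: "'a set \<Rightarrow> 'a set" where
  "core B = \<Union>{C. C \<subseteq> V - B \<and> (\<forall>v\<in>C. 2 \<le> card (N v \<inter> C))}"

text \<open>These vertices are isolated in the graph induced on V - B, and they are the only ones
  that can have six star conflicts.\<close>

definition crowded :: "'a set \<Rightarrow> 'a set" where
  "crowded B = {v \<in> V - B. 3 \<le> card (N v \<inter> B)}"

lemma core_subset: "core B \<subseteq> V - B"
  unfolding core_def by blast

lemma core_card: "v \<in> core B \<Longrightarrow> 2 \<le> card (N v \<inter> core B)"
proof -
  assume "v \<in> core B"
  then obtain C where C: "v \<in> C" "C \<subseteq> V - B" "\<forall>v\<in>C. 2 \<le> card (N v \<inter> C)"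
    unfolding core_def by blast
  then have "C \<subseteq> core B" unfolding core_def by blast
  then have "card (N v \<inter> C) \<le> card (N v \<inter> core B)" by (intro card_mono) auto
  then show ?thesis using C by fastforce
qed

lemma core_maximal:
  "C \<subseteq> V - B \<Longrightarrow> (\<And>v. v \<in> C \<Longrightarrow> 2 \<le> card (N v \<inter> C)) \<Longrightarrow> C \<subseteq> core B"
  unfolding core_def by blast

lemma finite_core: "finite (core B)"
  using core_subset finite_V by (meson finite_Diff finite_subset)

lemma finite_crowded: "finite (crowded B)"
  unfolding crowded_def using finite_V by simp

lemma card_split_N: "card (N v \<inter> B) + card (N v - B) \<le> 3"
  using card_N[of v] card_Int_Diff[of "N v" B] by simp

text \<open>Maximality of \<open>B\<close> gives one neighbour in \<open>B\<close>, the cycle gives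
  two outside, and degree three leaves no room for more.\<close>

lemma core_neighbours:
  assumes "max_indep B" "v \<in> core B"
  shows "card (N v \<inter> B) = 1" "N v - B = N v \<inter> core B" "card (N v - B) = 2"
proof -
  have sub: "N v \<inter> core B \<subseteq> N v - B" using core_subset by blast
  then have 1: "card (N v \<inter> core B) \<le> card (N v - B)" by (intro card_mono) auto
  have "N v \<inter> B \<noteq> {}" using assms core_subset unfolding max_indep_def by blast
  then have 2: "1 \<le> card (N v \<inter> B)" by (simp add: Suc_leI card_gt_0_iff)
  show "card (N v \<inter> B) = 1" "card (N v - B) = 2"
    using 1 2 core_card[OF assms(2)] card_split_N[of v B] by linarith+
  then show "N v - B = N v \<inter> core B"
    using card_seteq[OF _ sub] core_card[OF assms(2)] by auto
qed

lemma core_unique: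
  assumes "max_indep B" "v \<in> core B" "t \<in> N v" "t \<in> B" "t' \<in> N v" "t' \<in> B"
  shows "t = t'"
proof -
  obtain z where "N v \<inter> B = {z}"
    using core_neighbours(1)[OF assms(1,2)] by (auto simp: card_1_singleton_iff)
  then show ?thesis using assms(3-6) by (metis IntI singletonD)
qed

lemma crowded_neighbours: "v \<in> crowded B \<Longrightarrow> N v \<subseteq> B"
proof -
  assume "v \<in> crowded B"
  then have "card (N v) \<le> card (N v \<inter> B)" using card_N[of v] unfolding crowded_def by simp
  then have "N v \<inter> B = N v" by (intro card_seteq) auto
  then show ?thesis by blast
qed

lemma exists_max_indep: "\<exists>B. max_indep B"
proof -
  let ?P = "\<lambda>B. B \<subseteq> V \<and> (\<forall>b\<in>B. N b \<inter> B = {})"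
  have "\<exists>B. ?P B \<and> (\<forall>B'. ?P B' \<longrightarrow> card B' \<le> card B)"
  proof (rule ex_has_greatest_nat)
    show "?P {}" by simp
    show "\<forall>B'. ?P B' \<longrightarrow> card B' < Suc (card V)"
      using finite_V card_mono less_Suc_eq_le by blast
  qed
  then obtain B where B: "?P B" "\<And>B'. ?P B' \<Longrightarrow> card B' \<le> card B" by blast
  have "N v \<inter> B \<noteq> {}" if "v \<in> V - B" for v
  proof
    assume "N v \<inter> B = {}"
    then have "?P (insert v B)" using B(1) that N_sym N_irrefl by auto
    then have "card (insert v B) \<le> card B" using B(2) by blast
    moreover have "finite B" using B(1) finite_V finite_subset by blast
    ultimately show False using that by simp
  qed
  then show ?thesis unfolding max_indep_def using B(1) by blast
qed

text \<open>Lexicographic minimisation of two cardinalities. Minimality is stated with inclusions of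
  cores because this is the form in which the two exchanges below contradict it.\<close>

lemma exists_minimal_max_indep:
  "\<exists>B. max_indep B \<and> (\<forall>B1. max_indep B1 \<longrightarrow> \<not> core B1 \<subset> core B) \<and>
     (\<forall>B1. max_indep B1 \<longrightarrow> core B1 \<subseteq> core B \<longrightarrow> card (crowded B) \<le> card (crowded B1))"
proof -
  obtain B0 where B0: "max_indep B0" "\<And>B1. max_indep B1 \<Longrightarrow> card (core B0) \<le> card (core B1)"
    using ex_has_least_nat[of max_indep _ "\<lambda>B. card (core B)"] exists_max_indep by blast
  let ?P = "\<lambda>B. max_indep B \<and> card (core B) = card (core B0)"
  obtain B where B: "?P B" "\<And>B1. ?P B1 \<Longrightarrow> card (crowded B) \<le> card (crowded B1)"
    using ex_has_least_nat[of ?P B0 "\<lambda>B. card (crowded B)"] B0(1) by blast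
  have "\<not> core B1 \<subset> core B" if "max_indep B1" for B1
  proof
    assume "core B1 \<subset> core B"
    then have "card (core B1) < card (core B)" by (rule psubset_card_mono[OF finite_core])
    then show False using B(1) B0(2)[OF that] by simp
  qed
  moreover have "card (crowded B) \<le> card (crowded B1)" if "max_indep B1" "core B1 \<subseteq> core B" for B1
  proof (rule B(2))
    have "card (core B1) \<le> card (core B)" using that(2) by (rule card_mono[OF finite_core])
    then show "?P B1" using B(1) B0(2)[OF that(1)] that(1) by simp
  qed
  ultimately show ?thesis using B(1) by blast
qed

end

section \<open>Two exchanges that improve the independent set\<close>

locale triangle_free_subcubic_graph = subcubic_graph +
  assumes triangle_free: "b \<in> N a \<Longrightarrow> c \<in> N b \<Longrightarrow> c \<notin> N a"
begin

text \<open>Replace \<open>t\<close> by \<open>s\<close> and by the set \<open>P\<close> of its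
  other neighbours that would be left without a neighbour in the set. All of these are neighbours of
  \<open>t\<close>, so they are independent as there is no triangle. The new outside vertex
  \<open>t\<close> has its neighbours \<open>s\<close> and \<open>y\<close> inside and hence lies on
  no cycle, so no cycle is created, while \<open>s\<close> leaves the core.\<close>

lemma core_exchange:
  assumes B: "max_indep B" and s: "s \<in> core B" and t: "t \<in> N s" "t \<in> B"
    and y: "y \<in> N t" "y \<noteq> s" "y \<in> core B"
  shows "\<exists>B1. max_indep B1 \<and> core B1 \<subset> core B"
proof -
  have indep: "\<And>b b'. b \<in> B \<Longrightarrow> b' \<in> N b \<Longrightarrow> b' \<notin> B" and BV: "B \<subseteq> V"
    using B unfolding max_indep_def by auto
  define P where "P = {z \<in> N t. z \<noteq> s \<and> N z \<inter> B = {t}}"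
  define B1 where "B1 = (B - {t}) \<union> {s} \<union> P"
  have sB: "s \<in> V - B" and yB: "y \<in> V - B" using s y core_subset by blast+
  have "N y \<inter> B = {t}" using core_unique[OF B y(3)] t(2) N_sym[OF y(1)] by blast
  then have yP: "y \<in> P" using y unfolding P_def by auto
  have sN: "b = t" if "b \<in> N s" "b \<in> B" for b using core_unique[OF B s that t] .
  have "N b \<inter> B1 = {}" if bB1: "b \<in> B1" for b
  proof -
    consider "b \<in> B" "b \<noteq> t" | "b = s" | "b \<in> P" using bB1 unfolding B1_def by auto
    then show ?thesis
    proof cases
      case 1
      then show ?thesis using indep sN N_sym unfolding B1_def P_def by auto
    next
      case 2
      have "z \<notin> N s" if "z \<in> P" for z using that triangle_free[OF t(1)] unfolding P_def by auto
      then show ?thesis using 2 sN N_irrefl unfolding B1_def by auto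
    next
      case 3
      have b: "b \<in> N t" "N b \<inter> B = {t}" "b \<noteq> s" using 3 unfolding P_def by auto
      have "z \<notin> N b" if "z \<in> P" for z
        using that b(1) triangle_free unfolding P_def by blast
      moreover have "s \<notin> N b" using b(1) triangle_free[OF t(1)] N_sym by blast
      ultimately show ?thesis using b(2) unfolding B1_def by auto
    qed
  qed
  moreover have "N x \<inter> B1 \<noteq> {}" if x: "x \<in> V - B1" for x
  proof (cases "x = t")
    case True
    then show ?thesis using N_sym[OF t(1)] unfolding B1_def by auto
  next
    case False
    then have xB: "x \<in> V - B" "x \<noteq> s" "x \<notin> P" using x unfolding B1_def by auto
    then have ne: "N x \<inter> B \<noteq> {}" using B unfolding max_indep_def by blast
    show ?thesis
    proof
      assume "N x \<inter> B1 = {}"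
      then have "N x \<inter> B = {t}" using ne unfolding B1_def by auto
      then have "x \<in> P" using xB N_sym unfolding P_def by auto
      then show False using xB by simp
    qed
  qed
  moreover have "B1 \<subseteq> V" using BV sB N_subset unfolding B1_def P_def by auto
  ultimately have "max_indep B1" unfolding max_indep_def by blast
  have t_core: "t \<notin> core B1"
  proof
    assume "t \<in> core B1"
    then have "2 \<le> card (N t \<inter> core B1)" by (rule core_card)
    also have "\<dots> \<le> card (N t - {s, y})"
      by (rule card_mono) (use core_subset[of B1] yP in \<open>auto simp: B1_def\<close>)
    also have "\<dots> \<le> 1"
      using card_N[of t] card_Diff_subset[of "{s, y}" "N t"] N_sym[OF t(1)] y by auto
    finally show False by simp
  qed
  have "core B1 \<subseteq> core B"
  proof (rule core_maximal)
    show "core B1 \<subseteq> V - B" using core_subset[of B1] t_core unfolding B1_def by auto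
  qed (rule core_card)
  moreover have "s \<notin> core B1" using core_subset[of B1] unfolding B1_def by auto
  ultimately show ?thesis using s \<open>max_indep B1\<close> by blast
qed

text \<open>Replace \<open>b\<close> by \<open>a1\<close>. The vertices \<open>a\<close> and
  \<open>a2\<close> stay dominated and stop being crowded; \<open>b\<close> becomes their only
  neighbour outside, so neither they nor \<open>b\<close> lie on a new cycle. Two vertices leave the
  crowded set and at most one enters.\<close>

lemma crowded_exchange:
  assumes B: "max_indep B" and a: "a \<in> crowded B" "a2 \<in> crowded B" "a \<noteq> a2"
    and b: "b \<in> B" "a \<in> N b" "a2 \<in> N b" "a1 \<in> N b" "a1 \<noteq> a" "a1 \<noteq> a2"
    and a1: "N a1 \<inter> B = {b}" and p: "p \<in> N a1" "p \<notin> B" "p2 \<in> N p" "p2 \<notin> B" "p2 \<noteq> a1"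
  shows "\<exists>B1. max_indep B1 \<and> core B1 \<subseteq> core B \<and> card (crowded B1) < card (crowded B)"
proof -
  have indep: "\<And>b b'. b \<in> B \<Longrightarrow> b' \<in> N b \<Longrightarrow> b' \<notin> B" and BV: "B \<subseteq> V"
    using B unfolding max_indep_def by auto
  define B1 where "B1 = insert a1 (B - {b})"
  have a1B: "a1 \<in> V - B" using indep b N_subset by blast
  have aB: "N a \<subseteq> B" "N a2 \<subseteq> B" using a crowded_neighbours by auto
  have "{a, a2, a1} \<subseteq> N b" "card {a, a2, a1} = 3" using a b by auto
  then have Nb: "N b = {a, a2, a1}" using card_N[of b] card_seteq[of "N b" "{a, a2, a1}"] by auto
  have a1N: "x = b" if "x \<in> N a1" "x \<in> B" for x using that a1 by blast
  have a1_ne: "a1 \<notin> N x" if "x \<in> B" "x \<noteq> b" for x using a1N[of x] N_sym[of a1 x] that by blast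
  have "N x \<inter> B1 = {}" if "x \<in> B1" for x
  proof (cases "x = a1")
    case True
    then show ?thesis using a1N N_irrefl[of a1] unfolding B1_def by blast
  next
    case False
    then show ?thesis using that indep a1_ne unfolding B1_def by blast
  qed
  moreover have "N x \<inter> B1 \<noteq> {}" if x: "x \<in> V - B1" for x
  proof -
    consider "x = b" | "x = a \<or> x = a2" | "x \<in> V - B" "b \<notin> N x"
      using x Nb N_sym unfolding B1_def by blast
    then show ?thesis
    proof cases
      case 1
      then show ?thesis using b unfolding B1_def by auto
    next
      case 2
      then have "3 \<le> card (N x \<inter> B)" using a unfolding crowded_def by auto
      then have "\<not> N x \<inter> B \<subseteq> {b}" using card_mono[of "{b}" "N x \<inter> B"] by auto
      then show ?thesis unfolding B1_def by auto
    next
      case 3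
      then have "N x \<inter> B \<noteq> {}" using B unfolding max_indep_def by blast
      then show ?thesis using 3 unfolding B1_def by auto
    qed
  qed
  moreover have "B1 \<subseteq> V" using BV a1B unfolding B1_def by auto
  ultimately have "max_indep B1" unfolding max_indep_def by blast
  have small: "card (N x \<inter> core B1) \<le> 1" if "x = a \<or> x = a2" for x
  proof -
    have "N x \<inter> core B1 \<subseteq> {b}" using that aB core_subset[of B1] unfolding B1_def by auto
    then show ?thesis using card_mono[of "{b}"] by fastforce
  qed
  have nc: "a \<notin> core B1" "a2 \<notin> core B1"
    using small[of a] small[of a2] core_card[of a B1] core_card[of a2 B1] by auto
  have "b \<notin> core B1"
  proof
    assume "b \<in> core B1"
    moreover have "N b \<inter> core B1 = {}" using Nb nc core_subset[of B1] unfolding B1_def by auto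
    ultimately show False using core_card[of b B1] by simp
  qed
  then have "core B1 \<subseteq> V - B" using core_subset[of B1] unfolding B1_def by blast
  then have "core B1 \<subseteq> core B" by (rule core_maximal) (rule core_card)
  moreover have "card (crowded B1) < card (crowded B)"
  proof -
    \<comment> \<open>A newly crowded vertex must be adjacent to \<open>a1\<close>. Of the
      neighbours of \<open>a1\<close>, \<open>b\<close> is excluded since it is adjacent to
      \<open>a\<close>, and \<open>p\<close> since it is adjacent to \<open>p2\<close>. At most one
      candidate remains.\<close>
    have sub: "crowded B1 \<subseteq> (crowded B - {a, a2}) \<union> (N a1 - {b, p})"
    proof
      fix v assume v: "v \<in> crowded B1"
      have vN: "N v \<subseteq> B1" by (rule crowded_neighbours[OF v])
      have vV: "v \<in> V" "v \<notin> B1" "3 \<le> card (N v \<inter> B1)" using v unfolding crowded_def by simp_all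
      have "b \<notin> B1" using b(1) a1B unfolding B1_def by blast
      then have "b \<notin> N v" using vN by blast
      then have va: "v \<noteq> a" "v \<noteq> a2" using N_sym[OF b(2)] N_sym[OF b(3)] by blast+
      have "a \<notin> B1" using a(1) b(5) unfolding B1_def crowded_def by simp
      then have v_b: "v \<noteq> b" using vN b(2) by blast
      have "p2 \<notin> B1" using p(4,5) unfolding B1_def by simp
      then have vp: "v \<noteq> p" using vN p(3) by blast
      show "v \<in> (crowded B - {a, a2}) \<union> (N a1 - {b, p})"
      proof (cases "v \<in> N a1")
        case True
        then show ?thesis using v_b vp by blast
      next
        case False
        then have "a1 \<notin> N v" using N_sym by blast
        then have "N v \<subseteq> B" using vN unfolding B1_def by blast
        then have "N v \<inter> B = N v \<inter> B1" using vN by auto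
        moreover have "v \<notin> B" using vV(2) v_b unfolding B1_def by blast
        ultimately have "v \<in> crowded B" using vV(1,3) unfolding crowded_def by simp
        then show ?thesis using va by blast
      qed
    qed
    have bp: "b \<noteq> p" "{b, p} \<subseteq> N a1" using b p N_sym by auto
    have "card (N a1 - {b, p}) = card (N a1) - card {b, p}"
      by (rule card_Diff_subset) (use bp in auto)
    then have "card (N a1 - {b, p}) \<le> 1" using card_N[of a1] bp by simp
    moreover have "card (crowded B - {a, a2}) = card (crowded B) - 2"
      using card_Diff_subset[of "{a, a2}" "crowded B"] a by simp
    moreover have "card {a, a2} \<le> card (crowded B)"
      using a by (intro card_mono[OF finite_crowded]) auto
    then have "2 \<le> card (crowded B)" using a by simp
    moreover have "card (crowded B1) \<le> card ((crowded B - {a, a2}) \<union> (N a1 - {b, p}))"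
      by (rule card_mono[OF _ sub]) (simp add: finite_crowded)
    then have "card (crowded B1) \<le> card (crowded B - {a, a2}) + card (N a1 - {b, p})"
      using card_Un_le order_trans by blast
    ultimately show ?thesis by linarith
  qed
  ultimately show ?thesis using \<open>max_indep B1\<close> by blast
qed

end

section \<open>Conflicts between stars and between edges inside A\<close>

text \<open>Minimality enters only through the two properties that the exchanges yield. A vertex of
  B has at most one neighbour on the cycles if it has any. If it has two crowded neighbours, and is
  the only neighbour in B of the third one, then no path of two edges inside A starts at that third
  neighbour.\<close>

locale minimal_max_indep = triangle_free_subcubic_graph +
  fixes B :: "'a set"
  assumes max_indep_B: "max_indep B"
    and core_block: "\<lbrakk>s \<in> core B; t \<in> N s; t \<in> B; y \<in> N t; y \<noteq> s\<rbrakk> \<Longrightarrow> y \<notin> core B"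
    and crowded_block: "\<lbrakk>a \<in> crowded B; a2 \<in> crowded B; a \<noteq> a2; b \<in> B; a \<in> N b; a2 \<in> N b; a1 \<in> N b;
      a1 \<noteq> a; a1 \<noteq> a2; N a1 \<inter> B = {b}; p \<in> N a1; p \<notin> B; p2 \<in> N p; p2 \<notin> B\<rbrakk> \<Longrightarrow> p2 = a1"
begin

definition A :: "'a set" where "A = V - B"

text \<open>The vertices of A whose star colour has to differ from that of a.\<close>

definition star_adj :: "'a \<Rightarrow> 'a set" where
  "star_adj a = ((N a - B) \<union> (\<Union>b\<in>N a \<inter> B. N b)) - {a}"

definition inner_edges :: "'a set set" where
  "inner_edges = {{a, b} | a b. a \<in> A \<and> b \<in> N a - B}"

text \<open>The walk condition for walks that stay inside A. Along a path or cycle of A, clashing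
  edges are two apart.\<close>

definition clash :: "'a set \<Rightarrow> 'a set \<Rightarrow> bool" where
  "clash e f \<longleftrightarrow> (\<exists>a b x d. a \<in> A \<and> b \<in> N a - B \<and> x \<in> N b - B \<and> d \<in> N x - B \<and> a \<noteq> x \<and> b \<noteq> d \<and>
     e = {a, b} \<and> f = {x, d})"

lemma N_in_A: "x \<in> N v - B \<Longrightarrow> x \<in> A"
  using N_subset unfolding A_def by blast

lemma B_indep: "b \<in> B \<Longrightarrow> N b \<inter> B = {}"
  using max_indep_B unfolding max_indep_def by blast

lemma N_B_A: "b \<in> B \<Longrightarrow> N b \<subseteq> A"
  using B_indep N_subset unfolding A_def by blast

lemma finite_A: "finite A" unfolding A_def using finite_V by simp

lemma finite_inner_edges: "finite inner_edges"
proof (rule finite_subset)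
  show "inner_edges \<subseteq> Pow A" unfolding inner_edges_def using N_in_A by auto
  show "finite (Pow A)" using finite_A by simp
qed

lemma A_card_B: "a \<in> A \<Longrightarrow> 1 \<le> card (N a \<inter> B)"
proof -
  assume "a \<in> A"
  then have "N a \<inter> B \<noteq> {}" using max_indep_B unfolding A_def max_indep_def by blast
  then show ?thesis by (simp add: Suc_le_eq card_gt_0_iff)
qed

lemma A_card_A: "a \<in> A \<Longrightarrow> card (N a - B) \<le> 2"
  using A_card_B[of a] card_split_N[of a B] by linarith

text \<open>Degree at most two inside A, in the form needed to follow a path: entering
  \<open>a\<close> from \<open>b\<close> leaves one way on.\<close>

lemma other_neighbour_unique:
  assumes "a \<in> A" "b \<in> N a - B" "x \<in> N a - B" "y \<in> N a - B" "x \<noteq> b" "y \<noteq> b"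
  shows "x = y"
proof (rule ccontr)
  assume "x \<noteq> y"
  then have "card {b, x, y} = 3" using assms by auto
  moreover have "card {b, x, y} \<le> card (N a - B)" by (rule card_mono) (use assms in auto)
  ultimately show False using A_card_A[OF assms(1)] by linarith
qed

lemma star_adj_subset: "star_adj a \<subseteq> A"
  unfolding star_adj_def using N_in_A N_B_A by blast

lemma star_adj_irrefl: "a \<notin> star_adj a"
  unfolding star_adj_def by simp

lemma finite_star_adj [simp]: "finite (star_adj a)"
  using star_adj_subset finite_A finite_subset by blast

lemma star_adj_sym: "a \<in> A \<Longrightarrow> a' \<in> star_adj a \<Longrightarrow> a \<in> star_adj a'"
  unfolding star_adj_def A_def using N_sym by blast

lemma card_star_adj: "card (star_adj a) \<le> card (N a - B) + (\<Sum>b\<in>N a \<inter> B. card (N b - {a}))"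
proof -
  have "star_adj a \<subseteq> (N a - B) \<union> (\<Union>b\<in>N a \<inter> B. N b - {a})" unfolding star_adj_def by auto
  then have "card (star_adj a) \<le> card ((N a - B) \<union> (\<Union>b\<in>N a \<inter> B. N b - {a}))" by (intro card_mono) auto
  also have "\<dots> \<le> card (N a - B) + card (\<Union>b\<in>N a \<inter> B. N b - {a})" by (rule card_Un_le)
  also have "card (\<Union>b\<in>N a \<inter> B. N b - {a}) \<le> (\<Sum>b\<in>N a \<inter> B. card (N b - {a}))"
    by (rule card_UN_le) simp
  finally show ?thesis by simp
qed

lemma card_block: "b \<in> N a \<Longrightarrow> card (N b - {a}) \<le> 2"
  using card_N_minus[of a b] N_sym by blast

text \<open>A neighbour in A contributes one conflict and a neighbour in B at most two, out of three
  neighbours altogether.\<close>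

lemma card_star_adj_le: "card (star_adj a) \<le> 3 + card (N a \<inter> B)"
proof -
  have "(\<Sum>b\<in>N a \<inter> B. card (N b - {a})) \<le> (\<Sum>b\<in>N a \<inter> B. 2)"
    by (rule sum_mono) (use card_block in auto)
  then show ?thesis using card_star_adj[of a] card_split_N[of a B] by simp
qed

lemma clash_sym: "clash e f \<Longrightarrow> clash f e"
proof -
  assume "clash e f"
  then obtain a b x d where *: "a \<in> A" "b \<in> N a - B" "x \<in> N b - B" "d \<in> N x - B" "a \<noteq> x" "b \<noteq> d"
    "e = {a, b}" "f = {x, d}" unfolding clash_def by blast
  have "d \<in> A" using *(4) N_in_A by blast
  moreover have "x \<in> N d - B" "b \<in> N x - B" "a \<in> N b - B"
    using * N_sym unfolding A_def by blast+
  moreover have "f = {d, x}" "e = {b, a}" using * by auto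
  ultimately show "clash f e" unfolding clash_def using *(5,6) by metis
qed

lemma clash_disjoint: "clash e f \<Longrightarrow> e \<inter> f = {}"
  unfolding clash_def using N_irrefl triangle_free N_sym by blast

lemma clash_inner_edges: "clash e f \<Longrightarrow> e \<in> inner_edges \<and> f \<in> inner_edges"
  unfolding clash_def inner_edges_def using N_in_A by blast

lemma inner_edges_endpoint:
  assumes "e \<in> inner_edges" "v \<in> e"
  obtains w where "e = {v, w}" "v \<in> A" "w \<in> N v - B" "w \<in> A"
proof -
  obtain a b where ab: "e = {a, b}" "a \<in> A" "b \<in> N a - B" using assms(1) unfolding inner_edges_def by blast
  have "b \<in> A" using ab N_in_A by blast
  have "a \<in> N b - B" using ab N_sym unfolding A_def by blast
  show thesis
  proof (cases "v = a")
    case True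
    then show thesis using that[of b] ab \<open>b \<in> A\<close> by simp
  next
    case False
    then have "v = b" using ab assms(2) by simp
    then show thesis using that[of a] ab \<open>b \<in> A\<close> \<open>a \<in> N b - B\<close> by (simp add: insert_commute)
  qed
qed

section \<open>Marking the cycles and two-colouring the remaining edges\<close>

text \<open>The minimal closed sets are the cycles of the graph induced on A.\<close>

definition closed :: "'a set \<Rightarrow> bool" where
  "closed C \<longleftrightarrow> C \<subseteq> core B \<and> C \<noteq> {} \<and> (\<forall>v\<in>C. N v - B \<subseteq> C)"

text \<open>Take a smallest set that meets all closed sets. Dropping \<open>m\<close> must miss some
  closed set, which therefore meets the set in \<open>m\<close> alone. In effect each cycle receives
  one mark.\<close>

lemma exists_marks:
  "\<exists>M. M \<subseteq> core B \<and> (\<forall>C. closed C \<longrightarrow> C \<inter> M \<noteq> {}) \<and> (\<forall>m\<in>M. \<exists>C. closed C \<and> C \<inter> M = {m})"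
proof -
  let ?H = "\<lambda>M. M \<subseteq> core B \<and> (\<forall>C. closed C \<longrightarrow> C \<inter> M \<noteq> {})"
  have "?H (core B)" unfolding closed_def by blast
  then obtain M where M: "?H M" "\<And>M'. ?H M' \<Longrightarrow> card M \<le> card M'"
    using ex_has_least_nat[of ?H "core B" card] by blast
  have finM: "finite M" using M(1) finite_core finite_subset by blast
  have "\<exists>C. closed C \<and> C \<inter> M = {m}" if "m \<in> M" for m
  proof -
    have "card (M - {m}) < card M" using that finM by (rule card_Diff1_less[rotated])
    then have "\<not> ?H (M - {m})" using M(2)[of "M - {m}"] by (metis not_le)
    then obtain C where C: "closed C" "C \<inter> (M - {m}) = {}" using M(1) by blast
    moreover have "C \<inter> M \<noteq> {}" using M(1) C(1) by blast
    ultimately have "C \<inter> M = {m}" by blast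
    then show ?thesis using C by blast
  qed
  then show ?thesis using M(1) by blast
qed

text \<open>If each edge of \<open>T\<close> clashed with two edges of \<open>T\<close>, then
  \<open>T\<close> could be continued at both ends of each edge, so its vertices would form a closed
  set and include a mark. Hence the clash graph on unmarked edges is 1-degenerate. Fixing 5 on edges
  without a clash keeps 6 available to the stars near them.\<close>

lemma A_edge_coloring:
  assumes hit: "\<forall>C. closed C \<longrightarrow> C \<inter> M \<noteq> {}"
  shows "\<exists>h. (\<forall>e\<in>inner_edges. e \<inter> M = {} \<longrightarrow> h e \<in> {5, 6::nat}) \<and>
    (\<forall>e f. e \<inter> M = {} \<longrightarrow> f \<inter> M = {} \<longrightarrow> clash e f \<longrightarrow> h e \<noteq> h f) \<and>
    (\<forall>e. (\<forall>f. \<not> clash e f) \<longrightarrow> h e = 5)"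
proof -
  define X where "X = {e \<in> inner_edges. e \<inter> M = {}}"
  have "\<exists>h. (\<forall>e\<in>X. h e \<in> {5, 6::nat}) \<and> (\<forall>e\<in>X. \<forall>f\<in>X. clash e f \<longrightarrow> h e \<noteq> h f)"
  proof (rule degenerate_list_coloring)
    show "finite X" unfolding X_def using finite_inner_edges by simp
    show "\<And>e f. clash e f \<Longrightarrow> clash f e" by (rule clash_sym)
    show "\<not> clash e e" for e
    proof
      assume "clash e e"
      then have "e \<noteq> {}" "e \<inter> e = {}" using clash_disjoint[of e e] unfolding clash_def by blast+
      then show False by simp
    qed
    fix T assume T: "T \<subseteq> X" "T \<noteq> {}"
    show "\<exists>e\<in>T. card {f \<in> T. clash e f} < card {5, 6::nat}"
    proof (rule ccontr)
      assume "\<not> ?thesis"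
      then have two: "2 \<le> card {f \<in> T. clash e f}" if "e \<in> T" for e using that by fastforce
      \<comment> \<open>If \<open>T\<close> stopped at \<open>b\<close>, every edge of
        \<open>T\<close> clashing with the edge ab would lie beyond \<open>a\<close>. As degrees
        inside A are at most two, there is at most one such edge.\<close>
      have next_vertex: "\<exists>x\<in>N b - B. x \<noteq> a \<and> x \<in> \<Union>T" if e: "{a, b} \<in> T" "a \<in> A" "b \<in> N a - B" for a b
      proof (rule ccontr)
        assume no: "\<not> ?thesis"
        define S where "S = {f. \<exists>x\<in>N a - B. \<exists>d\<in>N x - B. x \<noteq> b \<and> d \<noteq> a \<and> f = {x, d}}"
        have "f \<in> S" if f: "f \<in> T" "clash {a, b} f" for f
        proof -
          obtain a' b' x d where *: "b' \<in> N a' - B" "x \<in> N b' - B" "d \<in> N x - B" "a' \<noteq> x" "b' \<noteq> d"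
            "{a, b} = {a', b'}" "f = {x, d}" using f(2) unfolding clash_def by blast
          have "x \<in> \<Union>T" using *(7) f(1) by blast
          then have "\<not> (a' = a \<and> b' = b)" using no *(2,4) by metis
          then have "a' = b \<and> b' = a" using *(6) by (metis doubleton_eq_iff)
          then show ?thesis using *(2-5,7) unfolding S_def by auto
        qed
        then have sub: "{f \<in> T. clash {a, b} f} \<subseteq> S" by blast
        have "f = g" if "f \<in> S" "g \<in> S" for f g
        proof -
          obtain x d where x: "x \<in> N a - B" "d \<in> N x - B" "x \<noteq> b" "d \<noteq> a" "f = {x, d}"
            using \<open>f \<in> S\<close> unfolding S_def by blast
          obtain x' d' where x': "x' \<in> N a - B" "d' \<in> N x' - B" "x' \<noteq> b" "d' \<noteq> a" "g = {x', d'}"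
            using \<open>g \<in> S\<close> unfolding S_def by blast
          have xx: "x = x'" using other_neighbour_unique[OF e(2,3) x(1) x'(1) x(3) x'(3)] .
          have "a \<in> N x - B" using x(1) e(2) N_sym unfolding A_def by blast
          moreover have "x \<in> A" using x(1) N_in_A by blast
          ultimately have "d = d'" using other_neighbour_unique[of x a d d'] x x' xx by blast
          then show ?thesis using x x' xx by simp
        qed
        then have eq: "\<forall>f\<in>{f \<in> T. clash {a, b} f}. \<forall>g\<in>{f \<in> T. clash {a, b} f}. f = g"
          using sub by blast
        have "T \<subseteq> inner_edges" using T(1) unfolding X_def by blast
        then have "finite {f \<in> T. clash {a, b} f}" using finite_inner_edges by (simp add: finite_subset)
        then have "card {f \<in> T. clash {a, b} f} \<le> Suc 0" using eq by (simp add: card_le_Suc0_iff_eq)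
        then show False using two[OF e(1)] by simp
      qed
      have vertex: "N v - B \<subseteq> \<Union>T \<and> 2 \<le> card (N v \<inter> \<Union>T) \<and> v \<in> V - B" if v: "v \<in> \<Union>T" for v
      proof -
        obtain e where e: "e \<in> T" "v \<in> e" using v by blast
        then have "e \<in> inner_edges" using T unfolding X_def by blast
        then obtain w where w: "e = {v, w}" "v \<in> A" "w \<in> N v - B" "w \<in> A"
          using inner_edges_endpoint e(2) by blast
        have vw: "v \<in> N w - B" using w N_sym unfolding A_def by blast
        have "{w, v} \<in> T" using e w by (simp add: insert_commute)
        then obtain x where x: "x \<in> N v - B" "x \<noteq> w" "x \<in> \<Union>T" using next_vertex[OF _ w(4) vw] by blast
        have wT: "w \<in> \<Union>T" using e w by blast
        have "N v - B \<subseteq> \<Union>T"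
        proof
          fix z assume "z \<in> N v - B"
          then show "z \<in> \<Union>T"
            using other_neighbour_unique[OF w(2,3) _ x(1) _ x(2), of z] x(3) wT by blast
        qed
        moreover have "card {w, x} \<le> card (N v \<inter> \<Union>T)"
          by (rule card_mono) (use w x wT in auto)
        ultimately show ?thesis using x(2) w(2) unfolding A_def by simp
      qed
      have "\<Union>T \<subseteq> core B" by (rule core_maximal) (use vertex in blast)+
      moreover have "\<Union>T \<noteq> {}"
      proof -
        obtain e where "e \<in> T" using T by blast
        moreover then have "e \<noteq> {}" using T unfolding X_def inner_edges_def by blast
        ultimately show ?thesis by blast
      qed
      ultimately have "closed (\<Union>T)" unfolding closed_def using vertex by blast
      then have "\<Union>T \<inter> M \<noteq> {}" using hit by blast
      then show False using T unfolding X_def by blast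
    qed
  qed
  then obtain h where h: "\<And>e. e \<in> X \<Longrightarrow> h e \<in> {5, 6::nat}"
      "\<And>e f. e \<in> X \<Longrightarrow> f \<in> X \<Longrightarrow> clash e f \<Longrightarrow> h e \<noteq> h f" by blast
  \<comment> \<open>Edges without a clash impose no constraint on each other, so they can all be
    reset to 5.\<close>
  define h' where "h' e = (if \<forall>f. \<not> clash e f then 5 else h e)" for e
  have "h' e \<in> {5, 6}" if "e \<in> inner_edges" "e \<inter> M = {}" for e
    using h(1)[of e] that unfolding h'_def X_def by auto
  moreover have "h' e \<noteq> h' f" if "e \<inter> M = {}" "f \<inter> M = {}" "clash e f" for e f
  proof -
    have "e \<in> X" "f \<in> X" using that clash_inner_edges unfolding X_def by blast+
    then show ?thesis using h(2)[OF _ _ that(3)] that(3) clash_sym[OF that(3)] unfolding h'_def by auto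
  qed
  moreover have "h' e = 5" if "\<forall>f. \<not> clash e f" for e using that unfolding h'_def by simp
  ultimately show ?thesis by blast
qed

end

section \<open>Star colours on the 5-core\<close>

context minimal_max_indep
begin

definition star_core :: "'a set" where
  "star_core = \<Union>{S. S \<subseteq> A \<and> (\<forall>a\<in>S. 5 \<le> card (star_adj a \<inter> S))}"

lemma star_core_subset: "star_core \<subseteq> A"
  unfolding star_core_def by blast

lemma star_core_card: "a \<in> star_core \<Longrightarrow> 5 \<le> card (star_adj a \<inter> star_core)"
proof -
  assume "a \<in> star_core"
  then obtain S where S: "a \<in> S" "S \<subseteq> A" "\<forall>a\<in>S. 5 \<le> card (star_adj a \<inter> S)"
    unfolding star_core_def by blast
  then have "S \<subseteq> star_core" unfolding star_core_def by blast
  then have "card (star_adj a \<inter> S) \<le> card (star_adj a \<inter> star_core)" by (intro card_mono) auto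
  then show ?thesis using S by fastforce
qed

lemma star_core_maximal: "S \<subseteq> A \<Longrightarrow> (\<And>a. a \<in> S \<Longrightarrow> 5 \<le> card (star_adj a \<inter> S)) \<Longrightarrow> S \<subseteq> star_core"
  unfolding star_core_def by blast

lemma card_star_adj_star_core: "card (star_adj a \<inter> star_core) \<le> card (star_adj a)"
  by (rule card_mono) auto

lemma star_core_card_B: "a \<in> star_core \<Longrightarrow> 2 \<le> card (N a \<inter> B)"
  using star_core_card[of a] card_star_adj_le[of a] card_star_adj_star_core[of a] by linarith

lemma star_core_card_A: "a \<in> star_core \<Longrightarrow> card (N a - B) \<le> 1"
  using star_core_card_B[of a] card_split_N[of a B] by linarith

lemma star_core_star_adj_subset:
  assumes "a \<in> star_core" "card (star_adj a) \<le> 5"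
  shows "star_adj a \<subseteq> star_core"
proof -
  have "star_adj a \<inter> star_core = star_adj a"
    by (rule card_seteq) (use assms star_core_card[of a] in auto)
  then show ?thesis by blast
qed

text \<open>At most two neighbours in B allow at most five conflicts; the 5-core already requires
  five, so it contains them all.\<close>

lemma star_core_not_crowded:
  assumes "a \<in> star_core" "a \<notin> crowded B"
  shows "card (star_adj a) \<le> 5" "star_adj a \<subseteq> star_core"
proof -
  have "a \<in> V - B" using assms star_core_subset unfolding A_def by blast
  then have "card (N a \<inter> B) \<le> 2" using assms(2) unfolding crowded_def by simp
  then show "card (star_adj a) \<le> 5" using card_star_adj_le[of a] by linarith
  then show "star_adj a \<subseteq> star_core" using star_core_star_adj_subset assms(1) by blast
qed

text \<open>A vertex with a neighbour in A is not crowded, so all its conflicts, \<open>a'\<close>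
  among them, stay in the 5-core. Both ends have at most one neighbour in A, so the edge is a whole
  component there; it clashes with nothing and has colour 5.\<close>

lemma star_core_edge:
  assumes a: "a \<in> star_core" and a': "a' \<in> N a - B"
  shows "a' \<in> star_core" "N a - B = {a'}" "N a' - B = {a}"
proof -
  have single: "N v - B = {w}" if "v \<in> star_core" "w \<in> N v - B" for v w
    using star_core_card_A[OF that(1)] that(2) card_le_Suc0_iff_eq[of "N v - B"] by auto
  have "a \<notin> crowded B" using crowded_neighbours[of a B] a' by blast
  then have "star_adj a \<subseteq> star_core" using star_core_not_crowded a by blast
  moreover have "a' \<in> star_adj a" using a' N_irrefl[of a] unfolding star_adj_def by blast
  ultimately show "a' \<in> star_core" by blast
  show "N a - B = {a'}" using single[OF a a'] .
  have "a \<in> A" using a star_core_subset by blast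
  then have "a \<in> N a' - B" using a' N_sym unfolding A_def by blast
  then show "N a' - B = {a}" using single[OF \<open>a' \<in> star_core\<close>] by blast
qed

lemma isolated_no_clash:
  assumes "N a - B \<subseteq> {a'}" "N a' - B \<subseteq> {a}"
  shows "\<not> clash {a, a'} f"
proof
  assume "clash {a, a'} f"
  then obtain p q x where *: "x \<in> N q - B" "p \<noteq> x" "{a, a'} = {p, q}"
    unfolding clash_def by blast
  then have "(p = a \<and> q = a') \<or> (p = a' \<and> q = a)" by (metis doubleton_eq_iff)
  then show False using * assms by auto
qed

lemma star_core_no_clash:
  assumes "a \<in> star_core" "e \<in> inner_edges" "a \<in> e"
  shows "\<not> clash e f"
proof -
  obtain w where w: "e = {a, w}" "w \<in> N a - B" using inner_edges_endpoint[OF assms(2,3)] by blast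
  then show ?thesis using isolated_no_clash[of a w f] star_core_edge[OF assms(1) w(2)] by simp
qed

lemma crowded_no_edge: "a \<in> crowded B \<Longrightarrow> e \<in> inner_edges \<Longrightarrow> a \<notin> e"
proof
  assume a: "a \<in> crowded B" and e: "e \<in> inner_edges" "a \<in> e"
  obtain w where "w \<in> N a - B" using inner_edges_endpoint[OF e] by blast
  then show False using crowded_neighbours[OF a] by blast
qed

text \<open>Five conflicts inside and one outside make six, which is the maximum. So every neighbour
  of \<open>a\<close> in B has two further neighbours, and the one leading to \<open>a1\<close>
  yields \<open>a2\<close>.\<close>

lemma star_core_boundary:
  assumes a: "a \<in> star_core" "a \<in> crowded B" and a1: "a1 \<in> star_adj a" "a1 \<notin> star_core"
  obtains b a2 where "b \<in> B" "N b = {a, a1, a2}" "a2 \<noteq> a1" "a2 \<noteq> a" "star_adj a \<inter> star_core = star_adj a - {a1}" "a2 \<in> star_core"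
    "card (star_adj a \<inter> star_core) = 5"
proof -
  have NB: "N a \<subseteq> B" using crowded_neighbours[OF a(2)] .
  have 1: "card (star_adj a \<inter> star_core) \<le> card (star_adj a - {a1})" by (rule card_mono) (use a1 in auto)
  have 2: "card (star_adj a - {a1}) = card (star_adj a) - 1" using a1 by simp
  have "card (N a \<inter> B) \<le> 3" using card_split_N[of a B] by linarith
  then have 3: "card (star_adj a) \<le> 6" using card_star_adj_le[of a] by linarith
  have 4: "card (star_adj a) = 6" using 1 2 3 star_core_card[OF a(1)] by linarith
  have eq: "star_adj a \<inter> star_core = star_adj a - {a1}"
    by (rule card_seteq) (use a1 1 2 4 star_core_card[OF a(1)] in auto)
  have c5: "card (star_adj a \<inter> star_core) = 5" using eq 2 4 by simp
  obtain b where b: "b \<in> N a" "b \<in> B" "a1 \<in> N b" "a1 \<noteq> a" using a1(1) NB unfolding star_adj_def by auto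
  have "card (N b - {a}) = 2"
  proof (rule ccontr)
    assume "card (N b - {a}) \<noteq> 2"
    then have le1: "card (N b - {a}) \<le> 1" using card_block[OF b(1)] by linarith
    have "(\<Sum>c\<in>N a \<inter> B. card (N c - {a})) = card (N b - {a}) + (\<Sum>c\<in>N a \<inter> B - {b}. card (N c - {a}))"
      by (rule sum.remove) (use b in auto)
    also have "(\<Sum>c\<in>N a \<inter> B - {b}. card (N c - {a})) \<le> (\<Sum>c\<in>N a \<inter> B - {b}. 2)"
      by (rule sum_mono) (use card_block in auto)
    also have "\<dots> = 2 * (card (N a \<inter> B) - 1)" using b by simp
    finally have "(\<Sum>c\<in>N a \<inter> B. card (N c - {a})) \<le> 5"
      using le1 \<open>card (N a \<inter> B) \<le> 3\<close> by linarith
    moreover have "card (N a - B) = 0" using NB by (simp add: Diff_eq_empty_iff[THEN iffD2])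
    ultimately show False using card_star_adj[of a] 4 by linarith
  qed
  moreover have "a1 \<in> N b - {a}" using b by blast
  ultimately have "card (N b - {a} - {a1}) = 1" by simp
  then obtain a2 where a2: "N b - {a} - {a1} = {a2}" by (auto simp: card_1_singleton_iff)
  have "a \<in> N b" using b N_sym by blast
  then have Nb: "N b = {a, a1, a2}" using a2 b by blast
  have ne: "a2 \<noteq> a1" "a2 \<noteq> a" using a2 by blast+
  have "a2 \<in> star_adj a" using b Nb ne unfolding star_adj_def by blast
  then have "a2 \<in> star_core" using eq ne by blast
  then show thesis using that[of b a2] b Nb ne eq c5 by blast
qed

text \<open>There can be five or six conflicts, while only five colours are safe from the edges
  inside A. Each list therefore gains 5 or 6 where no nearby edge uses it, and the case distinction
  shows that the gain always suffices.\<close>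

lemma star_core_coloring:
  fixes h :: "'a set \<Rightarrow> nat"
  assumes h5: "\<forall>e. (\<forall>f. \<not> clash e f) \<longrightarrow> h e = 5"
  shows "\<exists>g. (\<forall>a\<in>star_core. g a < 7 \<and> (\<forall>e\<in>inner_edges. a \<notin> e \<longrightarrow> e \<inter> star_adj a \<noteq> {} \<longrightarrow> h e \<in> {5, 6} \<longrightarrow> g a \<noteq> h e)) \<and>
    (\<forall>a\<in>star_core. \<forall>a'\<in>star_core. a' \<in> star_adj a \<longrightarrow> g a \<noteq> g a')"
proof -
  define F where "F a x \<longleftrightarrow> (\<forall>e\<in>inner_edges. a \<notin> e \<longrightarrow> e \<inter> star_adj a \<noteq> {} \<longrightarrow> h e \<noteq> x)" for a x
  define L where "L a = {..<5} \<union> {x \<in> {5, 6::nat}. F a x}" for a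
  have finL: "finite (L a)" for a unfolding L_def by simp
  have L5: "5 \<le> card (L a)" for a
    using card_mono[OF finL, of "{..<5}" a] unfolding L_def by simp
  have L6: "6 \<le> card (L a)" if x: "x \<in> {5, 6}" "F a x" for a x
  proof -
    have "card (insert x {..<5}) \<le> card (L a)"
      by (rule card_mono[OF finL]) (use x in \<open>auto simp: L_def\<close>)
    moreover have "x \<notin> {..<5}" using x by auto
    ultimately show ?thesis by simp
  qed
  have L7: "7 \<le> card (L a)" if "F a 5" "F a 6" for a
  proof -
    have "{..<7} = {..<5} \<union> {5, 6::nat}" by auto
    then have "{..<7} \<subseteq> L a" using that unfolding L_def by auto
    then show ?thesis using card_mono[OF finL, of "{..<7}" a] by simp
  qed
  \<comment> \<open>An edge near \<open>a\<close> then touches the 5-core, where every edge inside A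
    has colour 5.\<close>
  have inner: "F a 6" if sub: "star_adj a \<subseteq> star_core" for a
    unfolding F_def
  proof (intro ballI impI)
    fix e assume e: "e \<in> inner_edges" "e \<inter> star_adj a \<noteq> {}"
    then obtain p where "p \<in> e" "p \<in> star_core" using sub by blast
    then show "h e \<noteq> 6" using spec[OF h5, of e] star_core_no_clash[of p e] e(1) by auto
  qed
  define R where "R a a' \<longleftrightarrow> a \<in> A \<and> a' \<in> star_adj a" for a a'
  have "\<exists>g. (\<forall>a\<in>star_core. g a \<in> L a) \<and> (\<forall>a\<in>star_core. \<forall>a'\<in>star_core. R a a' \<longrightarrow> g a \<noteq> g a')"
  proof (rule degenerate_list_coloring)
    show "finite star_core" using star_core_subset finite_A finite_subset by blast
    show "\<And>a a'. R a a' \<Longrightarrow> R a' a" unfolding R_def using star_adj_sym star_adj_subset by blast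
    show "\<And>a. \<not> R a a" unfolding R_def using star_adj_irrefl by blast
    fix T assume T: "T \<subseteq> star_core" "T \<noteq> {}"
    have RT: "{y \<in> T. R x y} = star_adj x \<inter> T" if "x \<in> T" for x
      using that T star_core_subset unfolding R_def by blast
    have G6: "card (star_adj x) \<le> 6" for x
      using card_star_adj_le[of x] card_split_N[of x B] by linarith
    have "\<exists>x\<in>T. card (star_adj x \<inter> T) < card (L x)"
    proof (cases "\<exists>x\<in>T. \<not> star_adj x \<inter> star_core \<subseteq> T")
      case True
      \<comment> \<open>A neighbour of \<open>x\<close> in the 5-core is missing from
        \<open>T\<close>. So \<open>x\<close> has at most five conflicts in \<open>T\<close> against
        six colours, or at most four against five.\<close>
      then obtain x where x: "x \<in> T" "\<not> star_adj x \<inter> star_core \<subseteq> T" by blast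
      have "star_adj x \<inter> T \<subset> star_adj x \<inter> star_core" using x T by blast
      then have lt: "card (star_adj x \<inter> T) < card (star_adj x \<inter> star_core)" by (intro psubset_card_mono) auto
      show ?thesis
      proof (cases "star_adj x \<subseteq> star_core")
        case True
        then have "6 \<le> card (L x)" using inner L6 by blast
        moreover have "card (star_adj x \<inter> star_core) \<le> 6" using card_star_adj_star_core[of x] G6[of x] by linarith
        ultimately show ?thesis using lt x(1) by (intro bexI[of _ x]) linarith+
      next
        case False
        then have "star_adj x \<inter> star_core \<subset> star_adj x" by blast
        then have "card (star_adj x \<inter> star_core) < card (star_adj x)" by (intro psubset_card_mono) auto
        then show ?thesis using lt x(1) G6[of x] L5[of x] by (intro bexI[of _ x]) linarith+
      qed
    next
      case False
      \<comment> \<open>From here on \<open>T\<close> contains every conflict of its members within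
        the 5-core.\<close>
      then have cl: "star_adj x \<inter> star_core \<subseteq> T" if "x \<in> T" for x using that by blast
      show ?thesis
      proof (cases "T \<subseteq> crowded B")
        case False
        then obtain x where x: "x \<in> T" "x \<notin> crowded B" by blast
        then have "card (star_adj x) \<le> 5" "star_adj x \<subseteq> star_core" using star_core_not_crowded T by blast+
        moreover have "card (star_adj x \<inter> T) \<le> card (star_adj x)" by (rule card_mono) auto
        moreover have "6 \<le> card (L x)" using inner L6 \<open>star_adj x \<subseteq> star_core\<close> by blast
        ultimately show ?thesis using x(1) by (intro bexI[of _ x]) linarith+
      next
        case True
        obtain x where x: "x \<in> T" using T by blast
        have xSg: "x \<in> star_core" "x \<in> crowded B" using x T True by blast+
        show ?thesis
        proof (cases "star_adj x \<subseteq> star_core")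
          case sub: True
          \<comment> \<open>No edge inside A meets a crowded vertex, so 5 and 6 are both free: seven
            colours against at most six conflicts.\<close>
          then have "star_adj x \<subseteq> crowded B" using cl[OF x] True by blast
          then have "F x c" for c unfolding F_def using crowded_no_edge by blast
          then have "7 \<le> card (L x)" using L7 by blast
          moreover have "card (star_adj x \<inter> T) \<le> card (star_adj x)" by (rule card_mono) auto
          ultimately show ?thesis using x G6[of x] by (intro bexI[of _ x]) linarith+
        next
          case False
          then obtain a1 where a1: "a1 \<in> star_adj x" "a1 \<notin> star_core" by blast
          obtain b a2 where b: "b \<in> B" "N b = {x, a1, a2}" "a2 \<noteq> a1" "a2 \<noteq> x"
              "star_adj x \<inter> star_core = star_adj x - {a1}" "a2 \<in> star_core" "card (star_adj x \<inter> star_core) = 5"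
            using star_core_boundary[OF xSg a1] by blast
          have rest: "star_adj x - {a1} \<subseteq> crowded B" using b(5) cl[OF x] True by blast
          have "a2 \<in> star_adj x" using b N_sym[of x b] b(4) unfolding star_adj_def by blast
          then have a2c: "a2 \<in> crowded B" using rest b(3) by blast
          \<comment> \<open>All conflicts of \<open>x\<close> other than \<open>a1\<close> are
            crowded, so only edges at \<open>a1\<close> can block 5 or 6. Five conflicts lie in the
            5-core, hence one of the two extra colours is enough.\<close>
          have a1e: "a1 \<in> e" if "e \<in> inner_edges" "e \<inter> star_adj x \<noteq> {}" for e
            using that rest crowded_no_edge by blast
          have "\<exists>c\<in>{5, 6}. F x c"
          proof (cases "\<forall>e\<in>inner_edges. a1 \<in> e \<longrightarrow> h e = 5")
            case True
            then have "F x 6" unfolding F_def using a1e by fastforce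
            then show ?thesis by blast
          next
            case False
            then obtain e0 where e0: "e0 \<in> inner_edges" "a1 \<in> e0" "h e0 \<noteq> 5" by blast
            \<comment> \<open>Two edges at \<open>a1\<close> would leave \<open>b\<close> as its
              only neighbour in B. By \<open>crowded_block\<close> the two edges then form a
              component of A, a path with no clash, so both would have colour 5. A single edge
              blocks at most one of 5 and 6.\<close>
            have uniq: "e = e0" if e: "e \<in> inner_edges" "a1 \<in> e" for e
            proof (rule ccontr)
              assume "e \<noteq> e0"
              obtain w where w: "e = {a1, w}" "w \<in> N a1 - B" "a1 \<in> A" using inner_edges_endpoint[OF e] by blast
              obtain w0 where w0: "e0 = {a1, w0}" "w0 \<in> N a1 - B" using inner_edges_endpoint[OF e0(1,2)] by blast
              have "w \<noteq> w0" using w w0 \<open>e \<noteq> e0\<close> by blast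
              then have "card {w, w0} = 2" by simp
              moreover have "card {w, w0} \<le> card (N a1 - B)" by (rule card_mono) (use w w0 in auto)
              ultimately have "card (N a1 \<inter> B) \<le> 1" using card_split_N[of a1 B] by linarith
              moreover have bN: "b \<in> N a1 \<inter> B" using b(1,2) N_sym[of a1 b] by blast
              ultimately have NB: "N a1 \<inter> B = {b}" using card_le_Suc0_iff_eq[of "N a1 \<inter> B"] by auto
              have "x \<in> N b" "a2 \<in> N b" "a1 \<in> N b" using b(2) by blast+
              moreover have "a1 \<noteq> x" using a1(1) star_adj_irrefl by blast
              ultimately have "N w0 - B \<subseteq> {a1}"
                using crowded_block[OF xSg(2) a2c b(4)[symmetric] b(1), of a1 w0] b(3) NB w0(2) by blast
              moreover have "N a1 - B \<subseteq> {w, w0}"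
              proof
                fix z assume "z \<in> N a1 - B"
                then show "z \<in> {w, w0}"
                  using other_neighbour_unique[OF w(3,2) _ w0(2), of z] \<open>w \<noteq> w0\<close> by blast
              qed
              ultimately have "\<not> clash e0 f" for f
              proof -
                have "N w - B \<subseteq> {a1}"
                  using crowded_block[OF xSg(2) a2c b(4)[symmetric] b(1), of a1 w] b(2,3) NB w(2) \<open>a1 \<noteq> x\<close>
                  by blast
                have "N w0 - B \<subseteq> {a1}" by fact
                show ?thesis
                proof
                  assume "clash e0 f"
                  then obtain p q u d where *: "q \<in> N p - B" "u \<in> N q - B" "d \<in> N u - B" "p \<noteq> u" "q \<noteq> d"
                      "e0 = {p, q}" unfolding clash_def by blast
                  then have "(p = a1 \<and> q = w0) \<or> (p = w0 \<and> q = a1)" using w0(1) by (metis doubleton_eq_iff)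
                  then show False
                    using * \<open>N w0 - B \<subseteq> {a1}\<close> \<open>N w - B \<subseteq> {a1}\<close> \<open>N a1 - B \<subseteq> {w, w0}\<close> by auto
                qed
              qed
              then show False using h5 e0(3) by blast
            qed
            show ?thesis
            proof (cases "h e0 = 6")
              case True
              then have "F x 5" unfolding F_def using a1e uniq by fastforce
              then show ?thesis by blast
            next
              case False
              \<comment> \<open>On an edge that does clash, nothing is known here about the value of
                \<open>h\<close>, so it may be neither 5 nor 6.\<close>
              then have "F x 6" unfolding F_def using a1e uniq by blast
              then show ?thesis by blast
            qed
          qed
          then have "6 \<le> card (L x)" using L6 by blast
          moreover have "card (star_adj x \<inter> T) \<le> card (star_adj x \<inter> star_core)" by (rule card_mono) (use T in auto)
          ultimately show ?thesis using x b(7) by (intro bexI[of _ x]) linarith+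
        qed
      qed
    qed
    then show "\<exists>x\<in>T. card {y \<in> T. R x y} < card (L x)" using RT by auto
  qed
  then obtain g where g: "\<And>a. a \<in> star_core \<Longrightarrow> g a \<in> L a"
      "\<And>a a'. a \<in> star_core \<Longrightarrow> a' \<in> star_core \<Longrightarrow> R a a' \<Longrightarrow> g a \<noteq> g a'" by blast
  have "g a < 7" if "a \<in> star_core" for a using g(1)[OF that] unfolding L_def by auto
  moreover have "g a \<noteq> h e" if "a \<in> star_core" "e \<in> inner_edges" "a \<notin> e" "e \<inter> star_adj a \<noteq> {}" "h e \<in> {5, 6}" for a e
    using g(1)[OF that(1)] that unfolding L_def F_def by auto
  moreover have "g a \<noteq> g a'" if "a \<in> star_core" "a' \<in> star_core" "a' \<in> star_adj a" for a a'
    using g(2)[of a a'] that star_core_subset unfolding R_def by blast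
  ultimately show ?thesis by blast
qed

end

section \<open>Star colours off the cycles and then on the cycles\<close>

context minimal_max_indep
begin

lemma core_A: "s \<in> core B \<Longrightarrow> s \<in> A"
  using core_subset unfolding A_def by blast

lemma core_N: "s \<in> core B \<Longrightarrow> N s - B \<subseteq> core B" "s \<in> core B \<Longrightarrow> card (N s - B) = 2"
  using core_neighbours[OF max_indep_B] by blast+

text \<open>Minimality excludes conflicts through B between cycle vertices, so among themselves they
  conflict only along the cycles.\<close>

lemma core_star_adj: "s \<in> core B \<Longrightarrow> star_adj s \<inter> core B \<subseteq> N s - B"
  unfolding star_adj_def using core_block by blast

lemma core_star_adj_card:
  assumes s: "s \<in> core B"
  shows "card (star_adj s - core B) \<le> 2"
proof -
  obtain t where t: "N s \<inter> B = {t}"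
    using core_neighbours(1)[OF max_indep_B s] by (auto simp: card_1_singleton_iff)
  have "star_adj s - core B \<subseteq> N t - {s}" using core_N(1)[OF s] t unfolding star_adj_def by auto
  then have "card (star_adj s - core B) \<le> card (N t - {s})" by (intro card_mono) auto
  also have "\<dots> \<le> 2" using card_block[of t s] t by blast
  finally show ?thesis .
qed

text \<open>Adding \<open>T\<close> to the 5-core produces a vertex with at most four conflicts in
  the union. It belongs to \<open>T\<close>, because vertices of the 5-core have five conflicts
  within the 5-core alone. Each conflict costs it one of five colours or counts as a neighbour in
  \<open>T\<close>.\<close>

lemma non_core_coloring:
  fixes g :: "'a \<Rightarrow> nat"
  assumes g: "\<forall>a\<in>star_core. \<forall>a'\<in>star_core. a' \<in> star_adj a \<longrightarrow> g a \<noteq> g a'"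
  shows "\<exists>f. (\<forall>a\<in>star_core. f a = g a) \<and> (\<forall>a\<in>A - star_core. f a < 5) \<and>
    (\<forall>a\<in>A - core B. \<forall>a'\<in>A - core B. a' \<in> star_adj a \<longrightarrow> f a \<noteq> f a')"
proof -
  define X where "X = A - star_core - core B"
  define L where "L a = {..<5} - g ` (star_adj a \<inter> star_core)" for a
  define R where "R a a' \<longleftrightarrow> a \<in> A \<and> a' \<in> star_adj a" for a a'
  have "\<exists>f. (\<forall>a\<in>X. f a \<in> L a) \<and> (\<forall>a\<in>X. \<forall>a'\<in>X. R a a' \<longrightarrow> f a \<noteq> f a')"
  proof (rule degenerate_list_coloring)
    show "finite X" unfolding X_def using finite_A by simp
    show "\<And>a a'. R a a' \<Longrightarrow> R a' a" unfolding R_def using star_adj_sym star_adj_subset by blast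
    show "\<And>a. \<not> R a a" unfolding R_def using star_adj_irrefl by blast
    fix T assume T: "T \<subseteq> X" "T \<noteq> {}"
    have "\<not> star_core \<union> T \<subseteq> star_core" using T unfolding X_def by blast
    moreover have SA: "star_core \<union> T \<subseteq> A" using T star_core_subset unfolding X_def by blast
    ultimately obtain a where a: "a \<in> star_core \<union> T" "\<not> 5 \<le> card (star_adj a \<inter> (star_core \<union> T))"
      using star_core_maximal[of "star_core \<union> T"] by blast
    have "card (star_adj a \<inter> star_core) \<le> card (star_adj a \<inter> (star_core \<union> T))" by (rule card_mono) auto
    then have "a \<notin> star_core" using a(2) star_core_card[of a] by linarith
    then have aT: "a \<in> T" using a(1) by blast
    have "card (star_adj a \<inter> (star_core \<union> T)) = card (star_adj a \<inter> star_core) + card (star_adj a \<inter> T)"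
      using T unfolding X_def Int_Un_distrib by (intro card_Un_disjoint) auto
    moreover have "card (g ` (star_adj a \<inter> star_core)) \<le> card (star_adj a \<inter> star_core)" by (rule card_image_le) simp
    moreover have "5 - card (g ` (star_adj a \<inter> star_core)) \<le> card (L a)"
      using diff_card_le_card_Diff[of "g ` (star_adj a \<inter> star_core)" "{..<5}"] unfolding L_def by simp
    ultimately have "card (star_adj a \<inter> T) < card (L a)" using a(2) by linarith
    moreover have "{y \<in> T. R a y} = star_adj a \<inter> T" using SA aT unfolding R_def by blast
    ultimately have "card {y \<in> T. R a y} < card (L a)" by simp
    then show "\<exists>x\<in>T. card {y \<in> T. R x y} < card (L x)" using aT by blast
  qed
  then obtain f where f: "\<And>a. a \<in> X \<Longrightarrow> f a \<in> L a"
      "\<And>a a'. a \<in> X \<Longrightarrow> a' \<in> X \<Longrightarrow> R a a' \<Longrightarrow> f a \<noteq> f a'" by blast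
  \<comment> \<open>On the cycles the value 0 is a placeholder until \<open>core_coloring\<close>
    supplies the colours.\<close>
  define f' where "f' a = (if a \<in> star_core then g a else if a \<in> X then f a else 0)" for a
  have "f' a < 5" if "a \<in> A - star_core" for a using that f(1)[of a] unfolding f'_def L_def by auto
  moreover have "f' a \<noteq> f' a'" if aa: "a \<in> A - core B" "a' \<in> A - core B" "a' \<in> star_adj a" for a a'
  proof -
    have sym: "a \<in> star_adj a'" using aa star_adj_sym by blast
    have "a \<in> A" "a' \<in> A" using aa by blast+
    have f'_X: "f' z = f z" if "z \<in> X" for z using that unfolding f'_def X_def by auto
    have f'_star_core: "f' z = g z" if "z \<in> star_core" for z using that unfolding f'_def by simp
    have mixed: "f z \<noteq> g z'" if "z \<in> X" "z' \<in> star_core" "z' \<in> star_adj z" for z z'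
    proof -
      have "g z' \<in> g ` (star_adj z \<inter> star_core)" using that by blast
      then show ?thesis using f(1)[OF that(1)] unfolding L_def by auto
    qed
    consider "a \<in> star_core" "a' \<in> star_core" | "a \<in> star_core" "a' \<in> X" | "a \<in> X" "a' \<in> star_core" | "a \<in> X" "a' \<in> X"
      using aa unfolding X_def by blast
    then show ?thesis
    proof cases
      case 1
      then show ?thesis using g 1 aa(3) f'_star_core by simp
    next
      case 2
      then show ?thesis using mixed[OF 2(2,1) sym] f'_star_core f'_X by metis
    next
      case 3
      then show ?thesis using mixed[OF 3 aa(3)] f'_star_core f'_X by metis
    next
      case 4
      then show ?thesis using f(2)[OF 4] f'_X aa(3) \<open>a \<in> A\<close> unfolding R_def by simp
    qed
  qed
  moreover have "f' a = g a" if "a \<in> star_core" for a using that unfolding f'_def by simp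
  ultimately show ?thesis by blast
qed

lemma special_subset_core:
  assumes "M \<subseteq> core B" "e \<in> inner_edges" "e \<inter> M \<noteq> {}"
  shows "e \<subseteq> core B"
proof -
  obtain m where m: "m \<in> e" "m \<in> M" using assms(3) by blast
  then obtain w where "e = {m, w}" "w \<in> N m - B" using inner_edges_endpoint[OF assms(2)] by blast
  then show ?thesis using m assms(1) core_N(1)[of m] by blast
qed

text \<open>Two conflicts off the cycles leave three of the five colours; each marked edge near
  \<open>s\<close>, collected in \<open>Sp s\<close>, may cost one more. The mark itself contains
  its marked edges, so it keeps three colours for two conflicts and is coloured last. Its neighbours
  come just before it, with two colours for one conflict still to face. For every other vertex a
  lost colour is matched by a cycle neighbour that is coloured later.\<close>

lemma core_coloring:
  fixes fn :: "'a \<Rightarrow> nat" and cs :: "'a set \<Rightarrow> nat"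
  assumes M: "M \<subseteq> core B" and sep: "\<forall>m\<in>M. \<exists>C. closed C \<and> C \<inter> M = {m}"
  shows "\<exists>f. (\<forall>s\<in>core B. f s < 5 \<and> f s \<notin> fn ` (star_adj s - core B) \<and>
      (\<forall>e\<in>inner_edges. e \<inter> M \<noteq> {} \<longrightarrow> s \<notin> e \<longrightarrow> e \<inter> star_adj s \<noteq> {} \<longrightarrow> f s \<noteq> cs e)) \<and>
    (\<forall>s\<in>core B. \<forall>s'\<in>core B. s' \<in> star_adj s \<longrightarrow> f s \<noteq> f s')"
proof -
  define Sp where "Sp s = {e \<in> inner_edges. e \<inter> M \<noteq> {} \<and> s \<notin> e \<and> e \<inter> star_adj s \<noteq> {}}" for s
  define L where "L s = {..<5} - (fn ` (star_adj s - core B) \<union> cs ` Sp s)" for s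
  define R where "R a a' \<longleftrightarrow> a \<in> A \<and> a' \<in> star_adj a" for a a'
  have finSp: "finite (Sp s)" for s unfolding Sp_def using finite_inner_edges by simp
  have L: "3 - card (Sp s) \<le> card (L s)" if s: "s \<in> core B" for s
  proof -
    let ?U = "fn ` (star_adj s - core B) \<union> cs ` Sp s"
    have "card ?U \<le> card (fn ` (star_adj s - core B)) + card (cs ` Sp s)" by (rule card_Un_le)
    moreover have "card (fn ` (star_adj s - core B)) \<le> card (star_adj s - core B)" by (rule card_image_le) simp
    moreover have "card (cs ` Sp s) \<le> card (Sp s)" by (rule card_image_le[OF finSp])
    ultimately have "card ?U \<le> 2 + card (Sp s)" using core_star_adj_card[OF s] by linarith
    moreover have "5 - card ?U \<le> card (L s)"
      using diff_card_le_card_Diff[of ?U "{..<5}"] finSp unfolding L_def by simp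
    ultimately show ?thesis by linarith
  qed
  have Sp_edge: "\<exists>p q. e = {p, q} \<and> p \<in> N s - B \<and> q \<in> N p - B" if s: "s \<in> core B" and e: "e \<in> Sp s" for s e
  proof -
    have e': "e \<in> inner_edges" "e \<inter> M \<noteq> {}" "e \<inter> star_adj s \<noteq> {}" using e unfolding Sp_def by blast+
    then obtain p where p: "p \<in> e" "p \<in> star_adj s" by blast
    have "p \<in> core B" using special_subset_core[OF M e'(1,2)] p(1) by blast
    then have "p \<in> N s - B" using core_star_adj[OF s] p(2) by blast
    moreover obtain q where "e = {p, q}" "q \<in> N p - B" using inner_edges_endpoint[OF e'(1) p(1)] by blast
    ultimately show ?thesis by blast
  qed
  \<comment> \<open>Marked edges near \<open>s\<close> stay within the closed set around
    \<open>s\<close>, so they all pass through its only mark.\<close>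
  have comp: "e \<inter> M = {m}" if m: "m \<in> M" "closed C" "C \<inter> M = {m}" and s: "s \<in> C" and e: "e \<in> Sp s" for m C s e
  proof -
    have "s \<in> core B" using m(2) s unfolding closed_def by blast
    then obtain p q where pq: "e = {p, q}" "p \<in> N s - B" "q \<in> N p - B" using Sp_edge e by blast
    then have "p \<in> C" using m(2) s unfolding closed_def by blast
    then have "q \<in> C" using m(2) pq unfolding closed_def by blast
    then have "e \<inter> M \<subseteq> {m}" using pq(1) \<open>p \<in> C\<close> m(3) by blast
    moreover have "e \<inter> M \<noteq> {}" using e unfolding Sp_def by blast
    ultimately show ?thesis by blast
  qed
  have Sp_mark: "Sp m = {}" if m: "m \<in> M" for m
  proof (rule ccontr)
    assume "Sp m \<noteq> {}"
    then obtain e where e: "e \<in> Sp m" by blast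
    obtain C where C: "closed C" "C \<inter> M = {m}" using bspec[OF sep, OF m] by blast
    have "m \<in> C" using C(2) by blast
    then have "m \<in> e" using comp[OF m C _ e] by blast
    then show False using e unfolding Sp_def by blast
  qed
  have Sp_nbr: "card (Sp v) \<le> 1" if v: "v \<in> core B" "m \<in> N v" "m \<in> M" for v m
  proof -
    obtain C where C: "closed C" "C \<inter> M = {m}" using bspec[OF sep, OF v(3)] by blast
    have mA: "m \<in> A" using v(3) M core_A by blast
    have vm: "v \<in> N m - B" using v core_subset N_sym by blast
    have "m \<in> C" using C(2) by blast
    then have vC: "v \<in> C" using C(1) vm unfolding closed_def by blast
    have "\<exists>q. e = {m, q} \<and> q \<in> N m - B \<and> q \<noteq> v" if e: "e \<in> Sp v" for e
    proof -
      have me: "m \<in> e" using comp[OF v(3) C vC e] by blast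
      have e': "e \<in> inner_edges" "v \<notin> e" using e unfolding Sp_def by blast+
      obtain q where "e = {m, q}" "q \<in> N m - B" using inner_edges_endpoint[OF e'(1) me] by blast
      then show ?thesis using e'(2) by blast
    qed
    then have "e = e'" if "e \<in> Sp v" "e' \<in> Sp v" for e e'
      using that other_neighbour_unique[OF mA vm] by metis
    then show ?thesis using card_le_Suc0_iff_eq[OF finSp] by auto
  qed
  \<comment> \<open>The neighbours of \<open>s\<close> that are adjacent to a mark: each brings at
    most one marked edge near \<open>s\<close>.\<close>
  define K where "K s = {p \<in> N s - B. N p \<inter> M \<noteq> {}}" for s
  have Sp_far: "card (Sp s) \<le> card (K s)" if s: "s \<in> core B" "s \<notin> M" "N s \<inter> M = {}" for s
  proof -
    have "Sp s \<subseteq> (\<lambda>p. {p, THE m. m \<in> N p \<inter> M}) ` K s"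
    proof
      fix e assume e: "e \<in> Sp s"
      obtain p q where pq: "e = {p, q}" "p \<in> N s - B" "q \<in> N p - B" using Sp_edge[OF s(1) e] by blast
      have "p \<notin> M" using pq(2) s(3) by blast
      moreover have "e \<inter> M \<noteq> {}" using e unfolding Sp_def by blast
      ultimately have qM: "q \<in> M" using pq(1) by blast
      have pA: "p \<in> A" using pq(2) N_in_A by blast
      have sp: "s \<in> N p - B" using s(1) pq(2) core_subset N_sym by blast
      have "m = q" if "m \<in> N p \<inter> M" for m
      proof (rule other_neighbour_unique[OF pA sp])
        show "m \<in> N p - B" using that M core_subset by blast
        show "m \<noteq> s" "q \<noteq> s" using that qM s(2) by blast+
      qed (rule pq(3))
      then have "(THE m. m \<in> N p \<inter> M) = q" using qM pq(3) by (intro the_equality) blast+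
      moreover have "p \<in> K s" unfolding K_def using pq qM by blast
      ultimately show "e \<in> (\<lambda>p. {p, THE m. m \<in> N p \<inter> M}) ` K s" using pq(1) by blast
    qed
    moreover have "finite (K s)" unfolding K_def by simp
    ultimately show ?thesis by (meson card_image_le card_mono finite_imageI le_trans)
  qed
  have "\<exists>f. (\<forall>a\<in>core B. f a \<in> L a) \<and> (\<forall>a\<in>core B. \<forall>a'\<in>core B. R a a' \<longrightarrow> f a \<noteq> f a')"
  proof (rule degenerate_list_coloring)
    show "finite (core B)" by (rule finite_core)
    show "\<And>a a'. R a a' \<Longrightarrow> R a' a" unfolding R_def using star_adj_sym star_adj_subset by blast
    show "\<And>a. \<not> R a a" unfolding R_def using star_adj_irrefl by blast
    fix T assume T: "T \<subseteq> core B" "T \<noteq> {}"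
    have RT: "{y \<in> T. R x y} \<subseteq> (N x - B) \<inter> T" if "x \<in> T" for x
      using that T core_star_adj[of x] unfolding R_def by blast
    have le: "card {y \<in> T. R x y} \<le> card ((N x - B) \<inter> T)" if "x \<in> T" for x
      by (rule card_mono[OF _ RT[OF that]]) simp
    \<comment> \<open>Peeling order: the marks, then their neighbours, then the rest. In the third
      case no vertex of \<open>K s\<close> is left in \<open>T\<close>, so each of them reduces
      colours and conflicts alike.\<close>
    consider m where "m \<in> T" "m \<in> M"
      | v m where "v \<in> T" "m \<in> N v" "m \<in> M" "m \<notin> T"
      | "T \<inter> M = {}" "\<And>v. v \<in> T \<Longrightarrow> N v \<inter> M = {}" by blast
    then show "\<exists>x\<in>T. card {y \<in> T. R x y} < card (L x)"
    proof cases
      case (1 m)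
      have mc: "m \<in> core B" using 1(1) T(1) by blast
      have "card ((N m - B) \<inter> T) \<le> card (N m - B)" by (rule card_mono) auto
      then have "card {y \<in> T. R m y} \<le> 2" using le[OF 1(1)] core_N(2)[OF mc] by linarith
      moreover have "3 \<le> card (L m)" using L[OF mc] Sp_mark[OF 1(2)] by simp
      ultimately show ?thesis using 1(1) by (intro bexI[of _ m]) linarith+
    next
      case (2 v m)
      have vc: "v \<in> core B" using 2(1) T(1) by blast
      have mN: "m \<in> N v - B" using 2(2,3) M core_subset by blast
      have "card ((N v - B) \<inter> T) \<le> card ((N v - B) - {m})" by (rule card_mono) (use 2(4) in auto)
      also have "\<dots> = 1" using mN core_N(2)[OF vc] by simp
      finally have "card {y \<in> T. R v y} \<le> 1" using le[OF 2(1)] by linarith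
      moreover have "2 \<le> card (L v)" using L[OF vc] Sp_nbr[OF vc 2(2,3)] by linarith
      ultimately show ?thesis using 2(1) by (intro bexI[of _ v]) linarith+
    next
      case 3
      obtain s where s: "s \<in> T" using T(2) by blast
      have sc: "s \<in> core B" using s T(1) by blast
      have KN: "K s \<subseteq> N s - B" unfolding K_def by blast
      have "(N s - B) \<inter> T \<subseteq> (N s - B) - K s" using 3(2) unfolding K_def by blast
      then have "card ((N s - B) \<inter> T) \<le> card ((N s - B) - K s)" by (intro card_mono) auto
      also have "\<dots> = 2 - card (K s)"
        using card_Diff_subset[OF _ KN] core_N(2)[OF sc] finite_subset[OF KN] by simp
      finally have "card {y \<in> T. R s y} \<le> 2 - card (K s)" using le[OF s] by linarith
      moreover have "card (K s) \<le> 2" using card_mono[OF _ KN] core_N(2)[OF sc] by simp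
      moreover have "3 - card (K s) \<le> card (L s)"
        using L[OF sc] Sp_far[OF sc _ 3(2)[OF s]] s 3(1) by fastforce
      ultimately show ?thesis using s by (intro bexI[of _ s]) linarith+
    qed
  qed
  then obtain f where f: "\<And>a. a \<in> core B \<Longrightarrow> f a \<in> L a"
      "\<And>a a'. a \<in> core B \<Longrightarrow> a' \<in> core B \<Longrightarrow> R a a' \<Longrightarrow> f a \<noteq> f a'" by blast
  have "f s < 5 \<and> f s \<notin> fn ` (star_adj s - core B) \<and>
      (\<forall>e\<in>inner_edges. e \<inter> M \<noteq> {} \<longrightarrow> s \<notin> e \<longrightarrow> e \<inter> star_adj s \<noteq> {} \<longrightarrow> f s \<noteq> cs e)" if "s \<in> core B" for s
    using f(1)[OF that] unfolding L_def Sp_def by auto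
  moreover have "f s \<noteq> f s'" if "s \<in> core B" "s' \<in> core B" "s' \<in> star_adj s" for s s'
    using f(2)[of s s'] that core_A unfolding R_def by blast
  ultimately show ?thesis by blast
qed

section \<open>Assembling the colouring in the triangle-free case\<close>

lemma seven_coloring: "\<exists>c. (\<forall>a b. b \<in> N a \<longrightarrow> c {a, b} < 7) \<and> walk_injective N c"
proof -
  obtain M where M: "M \<subseteq> core B" and hit: "\<forall>C. closed C \<longrightarrow> C \<inter> M \<noteq> {}"
    and sep: "\<forall>m\<in>M. \<exists>C. closed C \<and> C \<inter> M = {m}"
    using exists_marks by blast
  from A_edge_coloring[OF hit] obtain h :: "'a set \<Rightarrow> nat"
    where h0: "\<forall>e\<in>inner_edges. e \<inter> M = {} \<longrightarrow> h e \<in> {5, 6}"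
      "\<forall>e f. e \<inter> M = {} \<longrightarrow> f \<inter> M = {} \<longrightarrow> clash e f \<longrightarrow> h e \<noteq> h f"
      "\<forall>e. (\<forall>f. \<not> clash e f) \<longrightarrow> h e = 5"
    by (elim exE conjE)
  have h: "\<And>e. e \<in> inner_edges \<Longrightarrow> e \<inter> M = {} \<Longrightarrow> h e \<in> {5, 6}"
      "\<And>e f. e \<inter> M = {} \<Longrightarrow> f \<inter> M = {} \<Longrightarrow> clash e f \<Longrightarrow> h e \<noteq> h f"
    using h0 by simp_all
  from star_core_coloring[OF h0(3)] obtain g :: "'a \<Rightarrow> nat" where g0:
      "\<forall>a\<in>star_core. g a < 7 \<and> (\<forall>e\<in>inner_edges. a \<notin> e \<longrightarrow> e \<inter> star_adj a \<noteq> {} \<longrightarrow> h e \<in> {5, 6} \<longrightarrow> g a \<noteq> h e)"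
      "\<forall>a\<in>star_core. \<forall>a'\<in>star_core. a' \<in> star_adj a \<longrightarrow> g a \<noteq> g a'"
    by (elim exE conjE)
  have g: "\<And>a. a \<in> star_core \<Longrightarrow> g a < 7"
      "\<And>a e. a \<in> star_core \<Longrightarrow> e \<in> inner_edges \<Longrightarrow> a \<notin> e \<Longrightarrow> e \<inter> star_adj a \<noteq> {} \<Longrightarrow> h e \<in> {5, 6} \<Longrightarrow> g a \<noteq> h e"
    using bspec[OF g0(1)] by blast+
  from non_core_coloring[OF g0(2)] obtain fn :: "'a \<Rightarrow> nat" where fn0: "\<forall>a\<in>star_core. fn a = g a"
      "\<forall>a\<in>A - star_core. fn a < 5"
      "\<forall>a\<in>A - core B. \<forall>a'\<in>A - core B. a' \<in> star_adj a \<longrightarrow> fn a \<noteq> fn a'"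
    by (elim exE conjE)
  have fn: "\<And>a. a \<in> star_core \<Longrightarrow> fn a = g a" "\<And>a. a \<in> A - star_core \<Longrightarrow> fn a < 5"
      "\<And>a a'. a \<in> A - core B \<Longrightarrow> a' \<in> A - core B \<Longrightarrow> a' \<in> star_adj a \<Longrightarrow> fn a \<noteq> fn a'"
    using fn0 by simp_all
  \<comment> \<open>Each end of a marked edge has at most two conflicts off the cycles, and four
    forbidden colours leave one of five.\<close>
  have "\<exists>c<5. c \<notin> fn ` (\<Union>p\<in>e. star_adj p - core B)" if e: "e \<in> inner_edges" "e \<inter> M \<noteq> {}" for e
  proof -
    obtain a b where ab: "e = {a, b}" using e(1) unfolding inner_edges_def by blast
    have "a \<in> core B" "b \<in> core B" using special_subset_core[OF M e] ab by blast+
    have U: "(\<Union>p\<in>e. star_adj p - core B) = (star_adj a - core B) \<union> (star_adj b - core B)" using ab by auto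
    have "card (fn ` ((star_adj a - core B) \<union> (star_adj b - core B))) \<le> card ((star_adj a - core B) \<union> (star_adj b - core B))"
      by (rule card_image_le) simp
    also have "\<dots> \<le> card (star_adj a - core B) + card (star_adj b - core B)" by (rule card_Un_le)
    also have "\<dots> \<le> 4" using core_star_adj_card[OF \<open>a \<in> core B\<close>] core_star_adj_card[OF \<open>b \<in> core B\<close>] by linarith
    finally have le: "card (fn ` (\<Union>p\<in>e. star_adj p - core B)) \<le> 4" unfolding U .
    have "finite (fn ` (\<Union>p\<in>e. star_adj p - core B))" using ab by simp
    then have "\<not> {..<5} \<subseteq> fn ` (\<Union>p\<in>e. star_adj p - core B)"
      using le card_mono[of "fn ` (\<Union>p\<in>e. star_adj p - core B)" "{..<5}"] by auto
    then show ?thesis by blast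
  qed
  then obtain cs where cs: "\<And>e. e \<in> inner_edges \<Longrightarrow> e \<inter> M \<noteq> {} \<Longrightarrow> cs e < 5 \<and> cs e \<notin> fn ` (\<Union>p\<in>e. star_adj p - core B)"
    by metis
  from core_coloring[OF M sep, of fn cs] obtain fc :: "'a \<Rightarrow> nat" where fc0:
      "\<forall>s\<in>core B. fc s < 5 \<and> fc s \<notin> fn ` (star_adj s - core B) \<and>
        (\<forall>e\<in>inner_edges. e \<inter> M \<noteq> {} \<longrightarrow> s \<notin> e \<longrightarrow> e \<inter> star_adj s \<noteq> {} \<longrightarrow> fc s \<noteq> cs e)"
      "\<forall>s\<in>core B. \<forall>s'\<in>core B. s' \<in> star_adj s \<longrightarrow> fc s \<noteq> fc s'"
    by (elim exE conjE)
  have fc: "fc s < 5" "fc s \<notin> fn ` (star_adj s - core B)" if "s \<in> core B" for s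
    using bspec[OF fc0(1) that] by blast+
  have fc_special: "fc s \<noteq> cs e"
    if "s \<in> core B" "e \<in> inner_edges" "e \<inter> M \<noteq> {}" "s \<notin> e" "e \<inter> star_adj s \<noteq> {}" for s e
    using bspec[OF fc0(1) that(1)] that(2-) by simp
  have fc_core: "fc s \<noteq> fc s'" if "s \<in> core B" "s' \<in> core B" "s' \<in> star_adj s" for s s'
    using fc0(2) that by simp
  define f where "f a = (if a \<in> core B then fc a else fn a)" for a
  define k where "k e = (if e \<inter> M = {} then h e else cs e)" for e
  have f_less: "f a < 7" if "a \<in> A" for a
    using that fc(1)[of a] g(1)[of a] fn(1)[of a] fn(2)[of a] unfolding f_def by (cases "a \<in> core B"; cases "a \<in> star_core") simp_all
  have k_less: "k e < 7" if "e \<in> inner_edges" for e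
    using that h(1)[of e] cs[of e] unfolding k_def by (cases "e \<inter> M = {}") auto
  have star_star: "f a \<noteq> f a'" if aa: "a \<in> A" "a' \<in> A" "a' \<in> star_adj a" for a a'
  proof -
    have sym: "a \<in> star_adj a'" using aa star_adj_sym by blast
    consider "a \<in> core B" "a' \<in> core B" | "a \<in> core B" "a' \<notin> core B" | "a \<notin> core B" "a' \<in> core B"
      | "a \<notin> core B" "a' \<notin> core B" by blast
    then show ?thesis
    proof cases
      case 1
      then show ?thesis using fc_core aa unfolding f_def by simp
    next
      case 2
      then have "fn a' \<in> fn ` (star_adj a - core B)" using aa(3) by blast
      then show ?thesis using 2 fc(2)[of a] unfolding f_def by auto
    next
      case 3
      then have "fn a \<in> fn ` (star_adj a' - core B)" using sym by blast
      then show ?thesis using 3 fc(2)[of a'] unfolding f_def by auto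
    next
      case 4
      then show ?thesis using fn(3)[of a a'] aa unfolding f_def by simp
    qed
  qed
  \<comment> \<open>An unmarked edge has colour 5 or 6, which only stars of the 5-core use, and
    those avoided it. The colour of a marked edge was chosen against the stars off the cycles, and
    the stars on the cycles were chosen against that colour.\<close>
  have star_edge: "f a \<noteq> k e" if a: "a \<in> A" and e: "e \<in> inner_edges" "a \<notin> e" "e \<inter> star_adj a \<noteq> {}" for a e
  proof (cases "e \<inter> M = {}")
    case True
    have he: "h e \<in> {5, 6}" using h(1)[OF e(1) True] .
    consider "a \<in> core B" | "a \<notin> core B" "a \<in> star_core" | "a \<notin> core B" "a \<in> A - star_core" using a by blast
    then show ?thesis
    proof cases
      case 1
      then show ?thesis using fc(1)[of a] he True unfolding f_def k_def by auto
    next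
      case 2
      then show ?thesis using g(2)[OF _ e he] fn(1)[of a] True unfolding f_def k_def by simp
    next
      case 3
      then show ?thesis using fn(2)[of a] he True unfolding f_def k_def by auto
    qed
  next
    case False
    show ?thesis
    proof (cases "a \<in> core B")
      case True
      then show ?thesis using fc_special[OF True e(1) False e(2,3)] False unfolding f_def k_def by simp
    next
      case nc: False
      obtain p where "p \<in> e" "p \<in> star_adj a" using e(3) by blast
      then have "a \<in> (\<Union>p\<in>e. star_adj p - core B)" using star_adj_sym[OF a] nc by blast
      then have "fn a \<in> fn ` (\<Union>p\<in>e. star_adj p - core B)" by blast
      then show ?thesis using cs[OF e(1) False] nc False unfolding f_def k_def by auto
    qed
  qed
  have edge_edge: "k e \<noteq> k e'" if ee: "clash e e'" for e e'
  proof -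
    have AEs: "e \<in> inner_edges" "e' \<in> inner_edges" using clash_inner_edges[OF ee] by blast+
    consider "e \<inter> M = {}" "e' \<inter> M = {}" | "e \<inter> M = {}" "e' \<inter> M \<noteq> {}" | "e \<inter> M \<noteq> {}" "e' \<inter> M = {}"
      | m m' where "m \<in> e" "m \<in> M" "m' \<in> e'" "m' \<in> M" by blast
    then show ?thesis
    proof cases
      case 1
      then show ?thesis using h(2)[OF _ _ ee] unfolding k_def by simp
    next
      case 2
      then show ?thesis using h(1)[OF AEs(1)] cs[OF AEs(2)] unfolding k_def by auto
    next
      case 3
      then show ?thesis using h(1)[OF AEs(2)] cs[OF AEs(1)] unfolding k_def by auto
    next
      case 4
      \<comment> \<open>Clashing edges lie in the same closed set, so two marked ones would share
        its mark, but clashing edges are disjoint.\<close>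
      obtain C where C: "closed C" "C \<inter> M = {m}" using bspec[OF sep, OF 4(2)] by blast
      obtain a b x d where *: "b \<in> N a - B" "x \<in> N b - B" "d \<in> N x - B" "a \<in> A" "e = {a, b}" "e' = {x, d}"
        using ee unfolding clash_def by blast
      have "a \<in> N b - B" using * N_sym unfolding A_def by blast
      have cl: "\<And>v w. v \<in> C \<Longrightarrow> w \<in> N v - B \<Longrightarrow> w \<in> C" using C(1) unfolding closed_def by blast
      have "m \<in> C" using C(2) by blast
      then have "b \<in> C" using 4(1) * cl by auto
      then have "x \<in> C" "d \<in> C" using cl * by blast+
      then have "m' = m" using 4(3,4) *(6) C(2) by blast
      then show ?thesis using clash_disjoint[OF ee] 4(1,3) by blast
    qed
  qed
  \<comment> \<open>Since B is independent, an edge that meets B has exactly one end outside B, and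
    the description operator finds it.\<close>
  define col where "col e = (if e \<inter> B = {} then k e else f (THE a. a \<in> e \<and> a \<notin> B))" for e
  have col_star: "col {a, b} = f a" "col {b, a} = f a" if "a \<notin> B" "b \<in> B" for a b
  proof -
    have "(THE z. z \<in> {a, b} \<and> z \<notin> B) = a" using that by auto
    then show "col {a, b} = f a" using that unfolding col_def by auto
    then show "col {b, a} = f a" by (simp add: insert_commute)
  qed
  have col_edge: "col {a, b} = k {a, b}" if "a \<notin> B" "b \<notin> B" for a b
    using that unfolding col_def by auto
  have inV: "a \<in> V" "b \<in> V" if "b \<in> N a" for a b using that N_sym N_subset by blast+
  have AEI: "{a, b} \<in> inner_edges" if "b \<in> N a" "a \<notin> B" "b \<notin> B" for a b
    using that inV[OF that(1)] unfolding inner_edges_def A_def by blast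
  have nB: "b \<notin> B" if "b \<in> N a" "a \<in> B" for a b using that B_indep by blast
  have bound: "col {a, b} < 7" if "b \<in> N a" for a b
    using that inV[OF that] nB[OF that] col_star[of a b] col_star[of b a] col_edge[of a b] AEI[OF that]
      f_less[of a] f_less[of b] k_less[of "{a, b}"] unfolding A_def
    by (cases "a \<in> B"; cases "b \<in> B") auto
  define W where "W a b x d \<longleftrightarrow> b \<in> N a \<and> x \<in> N b \<and> d \<in> N x \<and> a \<noteq> x \<and> b \<noteq> d" for a b x d
  have W_rev: "W d x b a" if "W a b x d" for a b x d using that N_sym unfolding W_def by blast
  have W_ad: "a \<noteq> d" if "W a b x d" for a b x d
    using that triangle_free[of b a x] N_sym[of d x] unfolding W_def by blast
  have star: "col {a, b} \<noteq> col {x, d}" if W: "W a b x d" and B: "a \<in> B \<or> b \<in> B" for a b x d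
  proof -
    have w: "b \<in> N a" "x \<in> N b" "d \<in> N x" "a \<noteq> x" "b \<noteq> d" "b \<noteq> x" using W N_irrefl unfolding W_def by blast+
    have V: "a \<in> V" "b \<in> V" "x \<in> V" "d \<in> V" using w inV by blast+
    have s: "a \<in> N b" using w N_sym by blast
    \<comment> \<open>The centre of the star containing the first edge. Whether the walk leaves
      through \<open>c\<close> or through its end in B, a next vertex \<open>x\<close> in A is a
      star conflict of \<open>c\<close>.\<close>
    define c where "c = (if a \<in> B then b else a)"
    have c: "c \<in> A" "col {a, b} = f c" 
      using B nB[OF w(1)] V col_star[of a b] col_star[of b a] unfolding c_def A_def by auto
    have cne: "c \<noteq> x" "c \<noteq> d" using w W_ad[OF W] unfolding c_def by auto
    have cx: "x \<in> star_adj c" if "x \<notin> B"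
      using that B w s cne nB[OF w(1)] unfolding c_def star_adj_def by (auto split: if_splits)
    show ?thesis
    proof (cases "x \<in> B")
      case True
      then have "b \<notin> B" "d \<notin> B" using nB w N_sym by blast+
      then have "c = b" using B unfolding c_def by auto
      have "d \<in> star_adj b" using True w unfolding star_adj_def by blast
      moreover have "d \<in> A" using V \<open>d \<notin> B\<close> unfolding A_def by blast
      moreover have "col {x, d} = f d" using col_star[OF \<open>d \<notin> B\<close> True] by blast
      ultimately show ?thesis using star_star[of b d] c \<open>c = b\<close> by simp
    next
      case False
      have xA: "x \<in> A" using V False unfolding A_def by blast
      show ?thesis
      proof (cases "d \<in> B")
        case True
        then show ?thesis using star_star[OF c(1) xA cx[OF False]] c(2) col_star[OF False True] by simp
      next
        case dB: False
        have "{x, d} \<in> inner_edges" using AEI[OF w(3) False dB] .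
        then have "f c \<noteq> k {x, d}" by (rule star_edge[OF c(1)]) (use cne cx[OF False] in auto)
        then show ?thesis using c(2) col_edge[OF False dB] by simp
      qed
    qed
  qed
  have "col {a, b} \<noteq> col {x, d}" if W: "W a b x d" for a b x d
  proof -
    consider "a \<in> B \<or> b \<in> B" | "x \<in> B \<or> d \<in> B" | "a \<notin> B" "b \<notin> B" "x \<notin> B" "d \<notin> B" by blast
    then show ?thesis
    proof cases
      case 1
      then show ?thesis by (rule star[OF W])
    next
      case 2
      then have "d \<in> B \<or> x \<in> B" by blast
      then have "col {d, x} \<noteq> col {b, a}" by (rule star[OF W_rev[OF W]])
      then show ?thesis by (metis insert_commute)
    next
      case 3
      have "a \<in> A" using 3(1) W inV unfolding W_def A_def by blast
      then have "clash {a, b} {x, d}" using W 3 unfolding clash_def W_def by blast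
      then show ?thesis using edge_edge col_edge 3 by simp
    qed
  qed
  then have "walk_injective N col" unfolding walk_injective_def W_def by blast
  then show ?thesis using bound by blast
qed

end

section \<open>From the triangle-free case to the theorem\<close>

lemma (in triangle_free_subcubic_graph) triangle_free_coloring:
  "\<exists>c. (\<forall>a b. b \<in> N a \<longrightarrow> c {a, b} < 7) \<and> walk_injective N c"
proof -
  obtain B where B: "max_indep B" "\<And>B1. max_indep B1 \<Longrightarrow> \<not> core B1 \<subset> core B"
      "\<And>B1. max_indep B1 \<Longrightarrow> core B1 \<subseteq> core B \<Longrightarrow> card (crowded B) \<le> card (crowded B1)"
    using exists_minimal_max_indep by blast
  interpret minimal_max_indep V N B
  proof
    show "max_indep B" by fact
    show "y \<notin> core B" if "s \<in> core B" "t \<in> N s" "t \<in> B" "y \<in> N t" "y \<noteq> s" for s t y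
      using core_exchange[OF B(1) that] B(2) by blast
    show "p2 = a1" if "a \<in> crowded B" "a2 \<in> crowded B" "a \<noteq> a2" "b \<in> B" "a \<in> N b" "a2 \<in> N b" "a1 \<in> N b"
      "a1 \<noteq> a" "a1 \<noteq> a2" "N a1 \<inter> B = {b}" "p \<in> N a1" "p \<notin> B" "p2 \<in> N p" "p2 \<notin> B" for a a2 b a1 p p2
      using crowded_exchange[OF B(1) that] B(3) by (metis not_le)
  qed
  show ?thesis by (rule seven_coloring)
qed

text \<open>Strong induction on the number of vertices: a triangle is deleted together with its
  corners, and the triangle-free graphs are the base of the induction.\<close>

lemma subcubic_coloring:
  assumes "subcubic_graph V N"
  shows "\<exists>c. (\<forall>a b. b \<in> N a \<longrightarrow> c {a, b} < (7::nat)) \<and> walk_injective N c"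
  using assms
proof (induction "card V" arbitrary: V N rule: less_induct)
  case less
  interpret subcubic_graph V N by (rule less.prems)
  show ?case
  proof (cases "\<exists>u v w. v \<in> N u \<and> w \<in> N v \<and> w \<in> N u")
    case True
    then obtain u v w where tri: "v \<in> N u" "w \<in> N v" "w \<in> N u" by blast
    then have dist: "distinct [u, v, w]" using N_irrefl by auto
    define T where "T = {u, v, w}"
    define N' where "N' x = (if x \<in> T then {} else N x - T)" for x
    have "u \<in> V" using tri N_subset N_sym by blast
    have "subcubic_graph (V - T) N'"
    proof
      show "finite (V - T)" using finite_V by simp
      show "N' x \<subseteq> V - T" for x using N_subset[of x] unfolding N'_def by auto
      show "x \<in> N' y" if "y \<in> N' x" for x y
        using that N_sym[of y x] unfolding N'_def by (auto split: if_splits)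
      show "x \<notin> N' x" for x using N_irrefl[of x] unfolding N'_def by simp
      show "card (N' x) \<le> 3" for x
        using card_N[of x] card_mono[of "N x" "N x - T"] unfolding N'_def by auto
    qed
    moreover have "card (V - T) < card V"
      using \<open>u \<in> V\<close> finite_V unfolding T_def by (intro psubset_card_mono) auto
    ultimately obtain c where c: "\<forall>a b. b \<in> N' a \<longrightarrow> c {a, b} < (7::nat)" "walk_injective N' c"
      using less.hyps by blast
    show ?thesis
      using triangle_extension[OF dist tri] c unfolding N'_def T_def by blast
  next
    case False
    interpret triangle_free_subcubic_graph V N
      by unfold_locales (use False in blast)
    show ?thesis by (rule triangle_free_coloring)
  qed
qed

lemma walk_injective_imp_injective_edge_coloring:
  fixes E :: "'a set set"
  defines "N \<equiv> \<lambda>v. {w. {v, w} \<in> E}"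
  assumes card2: "\<And>e. e \<in> E \<Longrightarrow> card e = 2"
    and less: "\<forall>a b. b \<in> N a \<longrightarrow> c {a, b} < k" and inj: "walk_injective N c"
  shows "injective_edge_coloring E c k"
proof -
  have walk: "c {a, b} \<noteq> c {x, d}"
    if "{a, b} \<in> E" "{b, x} \<in> E" "{x, d} \<in> E" "a \<noteq> x" "b \<noteq> d" for a b x d
    using inj that unfolding walk_injective_def N_def by blast
  have "c e < k" if e: "e \<in> E" for e
  proof -
    obtain a b where "e = {a, b}" using card2[OF e] by (auto simp: card_2_iff)
    then show ?thesis using less e unfolding N_def by simp
  qed
  moreover have "c e \<noteq> c f" if ef: "e \<in> E" "f \<in> E" "e \<noteq> f" "edges_dist1 E e f" for e f
  proof -
    obtain b x where bx: "b \<in> e" "x \<in> f" "{b, x} \<in> E" "e \<inter> f = {}"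
      using ef(4) unfolding edges_dist1_def by blast
    obtain a where a: "e = {a, b}" using card2[OF ef(1)] bx(1) by (auto simp: card_2_iff)
    obtain d where d: "f = {x, d}" using card2[OF ef(2)] bx(2) by (auto simp: card_2_iff)
    have "a \<noteq> x" "b \<noteq> d" using bx(4) a d by auto
    then show ?thesis using walk[of a b x d] ef(1,2) bx(3) a d by blast
  qed
  moreover have "c e \<noteq> c f" if ef: "e \<noteq> f" "in_common_triangle E e f" for e f
  proof -
    obtain x y z where xyz: "x \<noteq> y" "y \<noteq> z" "x \<noteq> z" "{x, y} \<in> E" "{y, z} \<in> E" "{x, z} \<in> E"
      and e: "e \<in> {{x, y}, {y, z}, {x, z}}" and f: "f \<in> {{x, y}, {y, z}, {x, z}}"
      using ef(2) unfolding in_common_triangle_def by blast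
    have sym: "{y, x} \<in> E" "{z, y} \<in> E" "{z, x} \<in> E"
      "{y, x} = {x, y}" "{z, y} = {y, z}" "{z, x} = {x, z}" using xyz by (auto simp: insert_commute)
    \<comment> \<open>Two sides of a triangle are the first and last edge of a closed walk around it
      that starts and ends at their common vertex.\<close>
    have "c {x, y} \<noteq> c {y, z}" using walk[of y x z y] xyz sym by metis
    moreover have "c {x, y} \<noteq> c {x, z}" using walk[of x y z x] xyz sym by metis
    moreover have "c {y, z} \<noteq> c {x, z}" using walk[of z y x z] xyz sym by metis
    ultimately show ?thesis using e f ef(1) by auto
  qed
  ultimately show ?thesis unfolding injective_edge_coloring_def by blast
qed

theorem theorem1p4:
  fixes V :: "'a set" and E :: "'a set set"
  assumes "simple_graph V E"
    and "max_degree_le V E 3"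
  shows "injective_chromatic_index E \<le> 7"
proof -
  define N where "N v = {w. {v, w} \<in> E}" for v
  have card2: "\<And>e. e \<in> E \<Longrightarrow> card e = 2" and sub: "\<And>e. e \<in> E \<Longrightarrow> e \<subseteq> V" and fin: "finite V"
    using assms(1) unfolding simple_graph_def by blast+
  have "subcubic_graph V N"
  proof
    show "finite V" by (rule fin)
    show "N x \<subseteq> V" for x using sub unfolding N_def by blast
    show "x \<in> N y" if "y \<in> N x" for x y using that unfolding N_def by (simp add: insert_commute)
    show irrefl: "x \<notin> N x" for x using card2[of "{x}"] unfolding N_def by auto
    show "card (N x) \<le> 3" for x
    proof (cases "x \<in> V")
      case True
      have "inj_on (\<lambda>w. {x, w}) (N x)" by (auto simp: inj_on_def doubleton_eq_iff)
      then have "card (N x) = card ((\<lambda>w. {x, w}) ` N x)" by (simp add: card_image)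
      also have "\<dots> \<le> card {e \<in> E. x \<in> e}"
      proof (rule card_mono)
        have "E \<subseteq> Pow V" using sub by blast
        then show "finite {e \<in> E. x \<in> e}" using fin by (simp add: finite_subset)
      qed (auto simp: N_def)
      finally show ?thesis using assms(2) True unfolding max_degree_le_def degree_def by fastforce
    next
      case False
      then have "N x = {}" using sub unfolding N_def by blast
      then show ?thesis by simp
    qed
  qed
  then obtain c where c: "\<forall>a b. b \<in> N a \<longrightarrow> c {a, b} < (7::nat)" "walk_injective N c"
    using subcubic_coloring by blast
  have "injective_edge_coloring E c 7"
    by (rule walk_injective_imp_injective_edge_coloring) (use card2 c in \<open>auto simp: N_def[abs_def]\<close>)
  then show ?thesis unfolding injective_chromatic_index_def by (intro Least_le) blast
qed

end
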